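(* Let the setting described in the context hold and let $\phi_0\in V_B^{\sigma_0}$ with $\hat\beta(\phi_0)\in L^1(\Omega)$. For $i=1,2$ let $f_i\in L^2(0,T;H)$ and let $(\phi_i,\mu_i)\in H^1(0,T;H)\times L^2(0,T;V_A^{2r})$ be a solution of the limiting problem with forcing term $f=f_i$, i.e. $$(\partial_t\phi_i(t),v)+(A^r\mu_i(t),A^rv)=0\quad\text{for every } v\in V_A^r \text{ and a.a. } t\in(0,T),$$ $$\tau(\partial_t\phi_i(t),\phi_i(t)-v)+(\phi_i(t)-P\phi_i(t),\phi_i(t)-v)+\int_\Omega\hat\beta(\phi_i(t))+(\pi(\phi_i(t))-f_i(t),\phi_i(t)-v)\le(\mu_i(t),\phi_i(t)-v)+\int_\Omega\hat\beta(v)$$ for every $v\in H$ and a.a. $t\in(0,T)$, and $\phi_i(0)=\phi_0$. Then $$\|\phi_1-\phi_2\|_{L^\infty(0,T;H)}\le C_{cd}\,\|f_1-f_2\|_{L^2(0,T;H)},$$ with a constant $C_{cd}$ depending only on $\tau$, the Lipschitz constant $L_\pi$ of $\pi$, and $T$. In particular, for $f\in L^2(0,T;H)$, the first component $\phi$ of a solution $(\phi,\mu)$ of the limiting problem is uniquely determined.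
   Context: $\Omega\subset\mathbb{R}^3$ is a bounded, connected, smooth open set, $H:=L^2(\Omega)$ with norm $\|\cdot\|$ and inner product $(\cdot,\cdot)$, $T>0$. $A:D(A)\subset H\to H$ and $B:D(B)\subset H\to H$ are unbounded, monotone, selfadjoint linear operators with compact resolvents; $\{\lambda_j\}$, $\{\lambda'_j\}$ are the nondecreasing sequences of their eigenvalues (nonnegative, tending to $+\infty$) with complete orthonormal eigenvector systems $\{e_j\}$, $\{e'_j\}$. For $s>0$, $A^sv:=\sum_j\lambda_j^s(v,e_j)e_j$ on $V_A^s:=D(A^s)=\{v\in H:\sum_j|\lambda_j^s(v,e_j)|^2<\infty\}$, and analogously $B^s$ on $V_B^s:=D(B^s)$ with norm $\|v\|^2+\|B^sv\|^2$. $P:H\to H$ is the orthogonal projection onto $\ker B$. $r,\sigma_0,\tau$ are fixed positive numbers. Standing structural assumptions: either $\lambda_1>0$, or $0=\lambda_1<\lambda_2$ and $e_1$ is constant; if $\lambda_1=0$, constant functions belong to $V_B^\sigma$ for $\sigma\in(0,\sigma_0)$. $F=\hat\beta+\hat\pi$, with $\hat\beta:\mathbb{R}\to[0,+\infty]$ convex, proper, lower semicontinuous, $\hat\beta(0)=0$; $\hat\pi:\mathbb{R}\to\mathbb{R}$ of class $C^1$ with Lipschitz continuous derivative $\pi:=\hat\pi'$ (Lipschitz constant $L_\pi$); $\liminf_{|s|\to\infty}s^{-2}F(s)>0$. Convention: $\int_\Omega\hat\beta(v):=+\infty$ if $\hat\beta(v)\notin L^1(\Omega)$. *)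

theory Defs
  imports "HOL-Analysis.Analysis"
begin

type_synonym pt = "real^3"
type_synonym fn = "pt \<Rightarrow> real"

text \<open>Elements of H = L2(Omega) (represented by functions; equality is a.e.).\<close>
definition L2 :: "pt set \<Rightarrow> fn \<Rightarrow> bool" where
  "L2 \<Omega> v \<longleftrightarrow> v \<in> borel_measurable (lebesgue_on \<Omega>) \<and> integrable (lebesgue_on \<Omega>) (\<lambda>x. (v x)^2)"

definition ip :: "pt set \<Rightarrow> fn \<Rightarrow> fn \<Rightarrow> real" where
  "ip \<Omega> v w = (\<integral>x. v x * w x \<partial>lebesgue_on \<Omega>)"

definition nrm :: "pt set \<Rightarrow> fn \<Rightarrow> real" where
  "nrm \<Omega> v = sqrt (ip \<Omega> v v)"

definition ONB :: "pt set \<Rightarrow> (nat \<Rightarrow> fn) \<Rightarrow> bool" where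
  "ONB \<Omega> e \<longleftrightarrow> (\<forall>j. L2 \<Omega> (e j)) \<and> (\<forall>i j. ip \<Omega> (e i) (e j) = (if i = j then 1 else 0)) \<and>
     (\<forall>v. L2 \<Omega> v \<longrightarrow> (\<lambda>n. nrm \<Omega> (\<lambda>x. v x - (\<Sum>j<n. ip \<Omega> v (e j) * e j x))) \<longlonglongrightarrow> 0)"

text \<open>Spectral data (eigenvalues lam, eigenvectors e) of an unbounded monotone selfadjoint
  operator with compact resolvent: nondecreasing nonnegative eigenvalues tending to infinity,
  complete orthonormal eigenvectors.\<close>
definition spectral_data :: "pt set \<Rightarrow> (nat \<Rightarrow> real) \<Rightarrow> (nat \<Rightarrow> fn) \<Rightarrow> bool" where
  "spectral_data \<Omega> lam e \<longleftrightarrow> mono lam \<and> (\<forall>j. 0 \<le> lam j) \<and> filterlim lam at_top sequentially \<and> ONB \<Omega> e"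

definition spec_dom :: "pt set \<Rightarrow> (nat \<Rightarrow> real) \<Rightarrow> (nat \<Rightarrow> fn) \<Rightarrow> real \<Rightarrow> fn set" where
  "spec_dom \<Omega> lam e s = {v. L2 \<Omega> v \<and> summable (\<lambda>j. (lam j powr s * ip \<Omega> v (e j))^2)}"

definition spec_pow :: "pt set \<Rightarrow> (nat \<Rightarrow> real) \<Rightarrow> (nat \<Rightarrow> fn) \<Rightarrow> real \<Rightarrow> fn \<Rightarrow> fn" where
  "spec_pow \<Omega> lam e s v = (SOME w. L2 \<Omega> w \<and>
     (\<lambda>n. nrm \<Omega> (\<lambda>x. w x - (\<Sum>j<n. lam j powr s * ip \<Omega> v (e j) * e j x))) \<longlonglongrightarrow> 0)"

definition ker_proj :: "pt set \<Rightarrow> (nat \<Rightarrow> real) \<Rightarrow> (nat \<Rightarrow> fn) \<Rightarrow> fn \<Rightarrow> fn" where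
  "ker_proj \<Omega> lam e v = (\<lambda>x. \<Sum>j\<in>{j. lam j = 0}. ip \<Omega> v (e j) * e j x)"

text \<open>int_Omega betahat(v), equal to +infinity when betahat(v) is not in L1.\<close>
definition int_beta :: "pt set \<Rightarrow> (real \<Rightarrow> ennreal) \<Rightarrow> fn \<Rightarrow> ennreal" where
  "int_beta \<Omega> \<beta> v = (\<integral>\<^sup>+x. \<beta> (v x) \<partial>lebesgue_on \<Omega>)"

text \<open>L2(0,T;H), identified with L2((0,T) x Omega).\<close>
definition L2T :: "pt set \<Rightarrow> real \<Rightarrow> (real \<Rightarrow> fn) \<Rightarrow> bool" where
  "L2T \<Omega> T f \<longleftrightarrow> (\<lambda>(t,x). f t x) \<in> borel_measurable (lebesgue_on ({0<..<T} \<times> \<Omega>)) \<and>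
     integrable (lebesgue_on ({0<..<T} \<times> \<Omega>)) (\<lambda>(t,x). (f t x)^2)"

definition L2T_norm :: "pt set \<Rightarrow> real \<Rightarrow> (real \<Rightarrow> fn) \<Rightarrow> real" where
  "L2T_norm \<Omega> T f = sqrt (\<integral>(t,x). (f t x)^2 \<partial>lebesgue_on ({0<..<T} \<times> \<Omega>))"

definition L2T_dom :: "pt set \<Rightarrow> real \<Rightarrow> (nat \<Rightarrow> real) \<Rightarrow> (nat \<Rightarrow> fn) \<Rightarrow> real \<Rightarrow> (real \<Rightarrow> fn) \<Rightarrow> bool" where
  "L2T_dom \<Omega> T lam e s \<mu> \<longleftrightarrow> L2T \<Omega> T \<mu> \<and>
     (AE t in lebesgue_on {0<..<T}. \<mu> t \<in> spec_dom \<Omega> lam e s) \<and>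
     integrable (lebesgue_on {0<..<T}) (\<lambda>t. (nrm \<Omega> (spec_pow \<Omega> lam e s (\<mu> t)))^2)"

text \<open>phi in H1(0,T;H) with time derivative psi in L2(0,T;H); phi is the continuous
  representative, phi(t) = phi(0) + int_0^t psi(s) ds for every t in [0,T].\<close>
definition has_time_deriv :: "pt set \<Rightarrow> real \<Rightarrow> (real \<Rightarrow> fn) \<Rightarrow> (real \<Rightarrow> fn) \<Rightarrow> bool" where
  "has_time_deriv \<Omega> T \<phi> \<psi> \<longleftrightarrow> L2T \<Omega> T \<phi> \<and> L2T \<Omega> T \<psi> \<and> L2 \<Omega> (\<phi> 0) \<and>
     (AE x in lebesgue_on \<Omega>. set_integrable lborel {0..T} (\<lambda>s. \<psi> s x)) \<and>
     (\<forall>t\<in>{0..T}. AE x in lebesgue_on \<Omega>. \<phi> t x = \<phi> 0 x + (LINT s:{0..t}|lborel. \<psi> s x))"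

definition convex_ennreal :: "(real \<Rightarrow> ennreal) \<Rightarrow> bool" where
  "convex_ennreal \<beta> \<longleftrightarrow> (\<forall>x y a. 0 \<le> a \<and> a \<le> 1 \<longrightarrow>
      \<beta> (a * x + (1 - a) * y) \<le> ennreal a * \<beta> x + ennreal (1 - a) * \<beta> y)"

definition lsc_ennreal :: "(real \<Rightarrow> ennreal) \<Rightarrow> bool" where
  "lsc_ennreal \<beta> \<longleftrightarrow> (\<forall>c. closed {x. \<beta> x \<le> c})"

text \<open>Standing assumptions of the paper (A with data lam,e; B with data lam',e').\<close>
definition setting :: "pt set \<Rightarrow> (nat \<Rightarrow> real) \<Rightarrow> (nat \<Rightarrow> fn) \<Rightarrow> (nat \<Rightarrow> real) \<Rightarrow> (nat \<Rightarrow> fn) \<Rightarrow>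
    real \<Rightarrow> real \<Rightarrow> real \<Rightarrow> (real \<Rightarrow> ennreal) \<Rightarrow> (real \<Rightarrow> real) \<Rightarrow> (real \<Rightarrow> real) \<Rightarrow> real \<Rightarrow> bool" where
  "setting \<Omega> lam e lam' e' r \<sigma>0 \<tau> \<beta> \<pi>h \<pi> L \<longleftrightarrow>
     open \<Omega> \<and> bounded \<Omega> \<and> connected \<Omega> \<and>
     spectral_data \<Omega> lam e \<and> spectral_data \<Omega> lam' e' \<and>
     0 < r \<and> 0 < \<sigma>0 \<and> 0 < \<tau> \<and>
     (0 < lam 0 \<or> (0 = lam 0 \<and> lam 0 < lam 1 \<and> (\<exists>c. AE x in lebesgue_on \<Omega>. e 0 x = c))) \<and>
     (lam 0 = 0 \<longrightarrow> (\<forall>\<sigma>\<in>{0<..<\<sigma>0}. \<forall>c. (\<lambda>x. c) \<in> spec_dom \<Omega> lam' e' \<sigma>)) \<and>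
     convex_ennreal \<beta> \<and> lsc_ennreal \<beta> \<and> \<beta> 0 = 0 \<and>
     (\<forall>s. (\<pi>h has_real_derivative \<pi> s) (at s)) \<and>
     0 \<le> L \<and> (\<forall>a b. \<bar>\<pi> a - \<pi> b\<bar> \<le> L * \<bar>a - b\<bar>) \<and>
     Liminf at_infinity (\<lambda>s. (enn2ereal (\<beta> s) + ereal (\<pi>h s)) / ereal (s^2)) > 0"

definition limiting_solution :: "pt set \<Rightarrow> (nat \<Rightarrow> real) \<Rightarrow> (nat \<Rightarrow> fn) \<Rightarrow> (nat \<Rightarrow> real) \<Rightarrow> (nat \<Rightarrow> fn) \<Rightarrow>
    real \<Rightarrow> real \<Rightarrow> real \<Rightarrow> (real \<Rightarrow> ennreal) \<Rightarrow> (real \<Rightarrow> real) \<Rightarrow> fn \<Rightarrow> (real \<Rightarrow> fn) \<Rightarrow>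
    (real \<Rightarrow> fn) \<Rightarrow> (real \<Rightarrow> fn) \<Rightarrow> (real \<Rightarrow> fn) \<Rightarrow> bool" where
  "limiting_solution \<Omega> lam e lam' e' r \<tau> T \<beta> \<pi> \<phi>0 f \<phi> \<psi> \<mu> \<longleftrightarrow>
     has_time_deriv \<Omega> T \<phi> \<psi> \<and> L2T_dom \<Omega> T lam e (2 * r) \<mu> \<and>
     (AE t in lebesgue_on {0<..<T}. \<forall>v \<in> spec_dom \<Omega> lam e r.
        ip \<Omega> (\<psi> t) v + ip \<Omega> (spec_pow \<Omega> lam e r (\<mu> t)) (spec_pow \<Omega> lam e r v) = 0) \<and>
     (AE t in lebesgue_on {0<..<T}. \<forall>v. L2 \<Omega> v \<longrightarrow>
        ereal (\<tau> * ip \<Omega> (\<psi> t) (\<lambda>x. \<phi> t x - v x)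
               + ip \<Omega> (\<lambda>x. \<phi> t x - ker_proj \<Omega> lam' e' (\<phi> t) x) (\<lambda>x. \<phi> t x - v x))
        + enn2ereal (int_beta \<Omega> \<beta> (\<phi> t))
        + ereal (ip \<Omega> (\<lambda>x. \<pi> (\<phi> t x) - f t x) (\<lambda>x. \<phi> t x - v x))
        \<le> ereal (ip \<Omega> (\<mu> t) (\<lambda>x. \<phi> t x - v x)) + enn2ereal (int_beta \<Omega> \<beta> v)) \<and>
     (AE x in lebesgue_on \<Omega>. \<phi> 0 x = \<phi>0 x)"

end

theory Submission
  imports Defs
begin

text \<open>Write \<open>\<phi>, \<psi>, \<mu>, f\<close> for the differences of the two solutions and of the data. Testing each variational
  inequality with the other solution and adding gives, for almost every time,
  \<open>\<tau> (\<psi>, \<phi>) \<le> (\<mu>, \<phi>) + (f, \<phi>) + L \<parallel>\<phi>\<parallel>\<^sup>2\<close>, because \<open>I - P\<close> is monotone and the convex integrals cancel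
  (they are finite, as testing with \<open>0\<close> shows). In the eigenbasis of \<open>A\<close> the evolution equation reads
  \<open>\<phi>\<^sub>j' = \<psi>\<^sub>j = - \<lambda>\<^sub>j\<^sup>2\<^sup>r \<mu>\<^sub>j\<close> with \<open>\<phi>\<^sub>j(0) = 0\<close>, so summing over \<open>j\<close> by Parseval's identity yields
  \<open>\<integral>\<^sub>0\<^sup>t (\<psi>, \<phi>) = \<parallel>\<phi>(t)\<parallel>\<^sup>2 / 2\<close> and \<open>\<integral>\<^sub>0\<^sup>t (\<mu>, \<phi>) \<le> 0\<close>. Gronwall's lemma then gives the claim with
  \<open>C\<^sup>2 = exp ((2 L + 1) T / \<tau>) / \<tau>\<close>.\<close>

subsection \<open>Square-integrable functions\<close>

definition square_integrable :: "'a measure \<Rightarrow> ('a \<Rightarrow> real) \<Rightarrow> bool" where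
  "square_integrable M f \<longleftrightarrow> f \<in> borel_measurable M \<and> integrable M (\<lambda>x. (f x)\<^sup>2)"

definition inner_L2 :: "'a measure \<Rightarrow> ('a \<Rightarrow> real) \<Rightarrow> ('a \<Rightarrow> real) \<Rightarrow> real" where
  "inner_L2 M f g = (\<integral>x. f x * g x \<partial>M)"

definition norm_L2 :: "'a measure \<Rightarrow> ('a \<Rightarrow> real) \<Rightarrow> real" where
  "norm_L2 M f = sqrt (inner_L2 M f f)"

lemma square_integrable_measurable: "square_integrable M f \<Longrightarrow> f \<in> borel_measurable M"
  by (simp add: square_integrable_def)

lemma abs_mult_le_sum_squares: "\<bar>a * b\<bar> \<le> a\<^sup>2 + b\<^sup>2" for a b :: real
proof -
  have "2 * \<bar>a * b\<bar> \<le> a\<^sup>2 + b\<^sup>2"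
    using sum_squares_bound[of "\<bar>a\<bar>" "\<bar>b\<bar>"] by (simp add: abs_mult)
  then show ?thesis by linarith
qed

lemma square_integrable_bound:
  assumes g: "square_integrable M g" and f: "f \<in> borel_measurable M"
    and le: "AE x in M. \<bar>f x\<bar> \<le> \<bar>g x\<bar>"
  shows "square_integrable M f"
proof -
  have "AE x in M. norm ((f x)\<^sup>2) \<le> norm ((g x)\<^sup>2)"
    using le by eventually_elim (metis abs_le_square_iff abs_power2 real_norm_def)
  moreover have "(\<lambda>x. (f x)\<^sup>2) \<in> borel_measurable M"
    using f by (rule borel_measurable_power)
  ultimately show ?thesis
    using f g unfolding square_integrable_def by (blast intro: Bochner_Integration.integrable_bound)
qed

lemma integrable_mult_square_integrable:
  assumes "square_integrable M f" "square_integrable M g"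
  shows "integrable M (\<lambda>x. f x * g x)"
proof (rule Bochner_Integration.integrable_bound)
  show "integrable M (\<lambda>x. (f x)\<^sup>2 + (g x)\<^sup>2)"
    using assms by (simp add: square_integrable_def)
qed (use assms abs_mult_le_sum_squares in \<open>auto simp: square_integrable_def\<close>)

lemma square_integrable_zero: "square_integrable M (\<lambda>x. 0)"
  by (simp add: square_integrable_def)

lemma square_integrable_add:
  "square_integrable M f \<Longrightarrow> square_integrable M g \<Longrightarrow> square_integrable M (\<lambda>x. f x + g x)"
  using integrable_mult_square_integrable[of M f g]
  by (auto simp: square_integrable_def power2_sum mult.assoc)

lemma square_integrable_scale: "square_integrable M f \<Longrightarrow> square_integrable M (\<lambda>x. c * f x)"
  by (auto simp: square_integrable_def power_mult_distrib)

lemma square_integrable_diff: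
  "square_integrable M f \<Longrightarrow> square_integrable M g \<Longrightarrow> square_integrable M (\<lambda>x. f x - g x)"
  using square_integrable_add[of M f "\<lambda>x. (-1) * g x"] square_integrable_scale[of M g "-1"] by simp

lemma square_integrable_sum:
  "(\<And>j. j \<in> I \<Longrightarrow> square_integrable M (f j)) \<Longrightarrow> square_integrable M (\<lambda>x. \<Sum>j\<in>I. f j x)"
  by (induction I rule: infinite_finite_induct)
    (simp_all add: square_integrable_zero square_integrable_add)

lemma (in finite_measure) square_integrable_const: "square_integrable M (\<lambda>x. c)"
  by (simp add: square_integrable_def)

lemma (in finite_measure) square_integrable_Lipschitz_comp:
  assumes f: "square_integrable M f" and lip: "L-lipschitz_on UNIV h"
  shows "square_integrable M (\<lambda>x. h (f x))"
proof -
  have "h \<in> borel_measurable borel"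
    using lip by (intro borel_measurable_continuous_onI lipschitz_on_continuous_on)
  then have "(\<lambda>x. h (f x) - h 0) \<in> borel_measurable M"
    using f by (auto simp: square_integrable_def)
  moreover have "\<bar>h s - h 0\<bar> \<le> \<bar>L * s\<bar>" for s
    using lipschitz_onD[OF lip, of s 0] lipschitz_on_nonneg[OF lip] by (simp add: dist_real_def abs_mult)
  ultimately have "square_integrable M (\<lambda>x. h (f x) - h 0)"
    using square_integrable_scale[OF f, of L] by (auto intro: square_integrable_bound)
  from square_integrable_add[OF this square_integrable_const[of "h 0"]] show ?thesis by simp
qed

lemma inner_L2_commute: "inner_L2 M f g = inner_L2 M g f"
  by (simp add: inner_L2_def mult.commute)

lemma inner_L2_add_left:
  "square_integrable M f \<Longrightarrow> square_integrable M g \<Longrightarrow> square_integrable M h \<Longrightarrow>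
    inner_L2 M (\<lambda>x. f x + g x) h = inner_L2 M f h + inner_L2 M g h"
  by (simp add: inner_L2_def distrib_right integrable_mult_square_integrable)

lemma inner_L2_diff_left:
  "square_integrable M f \<Longrightarrow> square_integrable M g \<Longrightarrow> square_integrable M h \<Longrightarrow>
    inner_L2 M (\<lambda>x. f x - g x) h = inner_L2 M f h - inner_L2 M g h"
  by (simp add: inner_L2_def left_diff_distrib integrable_mult_square_integrable)

lemma inner_L2_scale_left: "inner_L2 M (\<lambda>x. c * f x) g = c * inner_L2 M f g"
  by (simp add: inner_L2_def mult.assoc)

lemma inner_L2_sum_left:
  assumes "\<And>j. j \<in> I \<Longrightarrow> square_integrable M (f j)" "square_integrable M g"
  shows "inner_L2 M (\<lambda>x. \<Sum>j\<in>I. f j x) g = (\<Sum>j\<in>I. inner_L2 M (f j) g)"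
  using assms
  by (simp add: inner_L2_def sum_distrib_right integrable_mult_square_integrable)

lemma inner_L2_add_right:
  "square_integrable M f \<Longrightarrow> square_integrable M g \<Longrightarrow> square_integrable M h \<Longrightarrow>
    inner_L2 M h (\<lambda>x. f x + g x) = inner_L2 M h f + inner_L2 M h g"
  by (simp add: inner_L2_def distrib_left integrable_mult_square_integrable)

lemma inner_L2_diff_right:
  "square_integrable M f \<Longrightarrow> square_integrable M g \<Longrightarrow> square_integrable M h \<Longrightarrow>
    inner_L2 M h (\<lambda>x. f x - g x) = inner_L2 M h f - inner_L2 M h g"
  by (simp add: inner_L2_def right_diff_distrib integrable_mult_square_integrable)

lemma inner_L2_scale_right: "inner_L2 M g (\<lambda>x. c * f x) = c * inner_L2 M g f"
  by (simp add: inner_L2_def mult.left_commute)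

lemma inner_L2_self_nonneg: "0 \<le> inner_L2 M f f"
  by (simp add: inner_L2_def)

lemma (in finite_measure) inner_L2_Lipschitz_diff_ge:
  assumes v: "square_integrable M v" and w: "square_integrable M w" and lip: "L-lipschitz_on UNIV h"
  shows "- (L * inner_L2 M (\<lambda>x. v x - w x) (\<lambda>x. v x - w x))
    \<le> inner_L2 M (\<lambda>x. h (v x) - h (w x)) (\<lambda>x. v x - w x)"
proof -
  have pointwise: "- L * ((a - b) * (a - b)) \<le> (h a - h b) * (a - b)" for a b
  proof -
    have "\<bar>(h a - h b) * (a - b)\<bar> \<le> L * \<bar>a - b\<bar> * \<bar>a - b\<bar>"
      using lipschitz_onD[OF lip, of a b] by (simp add: abs_mult dist_real_def mult_right_mono)
    also have "\<dots> = L * ((a - b) * (a - b))" by (simp add: mult.assoc)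
    finally show ?thesis by linarith
  qed
  have d: "square_integrable M (\<lambda>x. v x - w x)"
    by (rule square_integrable_diff[OF v w])
  have hd: "square_integrable M (\<lambda>x. h (v x) - h (w x))"
    by (rule square_integrable_diff[OF square_integrable_Lipschitz_comp[OF v lip]
          square_integrable_Lipschitz_comp[OF w lip]])
  have "(\<integral>x. - L * ((v x - w x) * (v x - w x)) \<partial>M) \<le> (\<integral>x. (h (v x) - h (w x)) * (v x - w x) \<partial>M)"
    using integrable_mult_square_integrable[OF d d] integrable_mult_square_integrable[OF hd d] pointwise
    by (intro integral_mono integrable_mult_right)
  then show ?thesis by (simp add: inner_L2_def)
qed

lemma norm_L2_nonneg: "0 \<le> norm_L2 M f"
  by (simp add: norm_L2_def inner_L2_self_nonneg)

lemma norm_L2_square: "(norm_L2 M f)\<^sup>2 = inner_L2 M f f"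
  by (simp add: norm_L2_def inner_L2_self_nonneg)

lemma norm_L2_tendsto_zero_iff:
  "((\<lambda>n. norm_L2 M (f n)) \<longlongrightarrow> 0) F \<longleftrightarrow> ((\<lambda>n. inner_L2 M (f n) (f n)) \<longlongrightarrow> 0) F"
proof
  assume "((\<lambda>n. norm_L2 M (f n)) \<longlongrightarrow> 0) F"
  from tendsto_power[OF this, of 2] show "((\<lambda>n. inner_L2 M (f n) (f n)) \<longlongrightarrow> 0) F"
    by (simp add: norm_L2_square)
next
  assume "((\<lambda>n. inner_L2 M (f n) (f n)) \<longlongrightarrow> 0) F"
  from tendsto_real_sqrt[OF this] show "((\<lambda>n. norm_L2 M (f n)) \<longlongrightarrow> 0) F"
    by (simp add: norm_L2_def)
qed

lemma inner_L2_double_le: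
  assumes "square_integrable M f" "square_integrable M g"
  shows "2 * inner_L2 M f g \<le> inner_L2 M f f + inner_L2 M g g"
  using assms inner_L2_self_nonneg[of M "\<lambda>x. f x - g x"]
  by (simp add: inner_L2_diff_left inner_L2_diff_right square_integrable_diff inner_L2_commute[of M g f])

lemma nn_integral_square:
  "square_integrable M f \<Longrightarrow> (\<integral>\<^sup>+x. ennreal ((f x)\<^sup>2) \<partial>M) = ennreal (inner_L2 M f f)"
  by (simp add: square_integrable_def inner_L2_def nn_integral_eq_integral flip: power2_eq_square)

lemma abs_inner_L2_le:
  assumes f: "square_integrable M f" and g: "square_integrable M g"
  shows "\<bar>inner_L2 M f g\<bar> \<le> norm_L2 M f * norm_L2 M g"
proof -
  have "ennreal \<bar>inner_L2 M f g\<bar> \<le> (\<integral>\<^sup>+x. ennreal \<bar>f x\<bar> * ennreal \<bar>g x\<bar> \<partial>M)"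
    using integral_norm_bound_ennreal[OF integrable_mult_square_integrable[OF f g]]
    by (simp add: inner_L2_def abs_mult flip: ennreal_mult)
  then have "(ennreal \<bar>inner_L2 M f g\<bar>)\<^sup>2 \<le> (\<integral>\<^sup>+x. ennreal \<bar>f x\<bar> * ennreal \<bar>g x\<bar> \<partial>M)\<^sup>2"
    by (rule power_mono) simp
  also have "\<dots> \<le> (\<integral>\<^sup>+x. (ennreal \<bar>f x\<bar>)\<^sup>2 \<partial>M) * (\<integral>\<^sup>+x. (ennreal \<bar>g x\<bar>)\<^sup>2 \<partial>M)"
    using square_integrable_measurable[OF f] square_integrable_measurable[OF g]
    by (intro Cauchy_Schwarz_nn_integral) auto
  also have "\<dots> = ennreal ((norm_L2 M f * norm_L2 M g)\<^sup>2)"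
    by (simp add: ennreal_power nn_integral_square f g power_mult_distrib norm_L2_square
        inner_L2_self_nonneg flip: ennreal_mult)
  finally have "\<bar>inner_L2 M f g\<bar>\<^sup>2 \<le> (norm_L2 M f * norm_L2 M g)\<^sup>2"
    by (simp only: ennreal_power abs_ge_zero ennreal_le_iff zero_le_power2)
  then show ?thesis
    by (rule power2_le_imp_le) (simp add: norm_L2_nonneg)
qed

lemma inner_L2_tendsto:
  assumes "square_integrable M f" "\<And>n. square_integrable M (s n)" "square_integrable M g"
    and lim: "(\<lambda>n. norm_L2 M (\<lambda>x. f x - s n x)) \<longlonglongrightarrow> 0"
  shows "(\<lambda>n. inner_L2 M (s n) g) \<longlonglongrightarrow> inner_L2 M f g"
proof (rule LIM_zero_cancel, rule Lim_null_comparison)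
  show "\<forall>\<^sub>F n in sequentially.
      norm (inner_L2 M (s n) g - inner_L2 M f g) \<le> norm_L2 M (\<lambda>x. f x - s n x) * norm_L2 M g"
    using abs_inner_L2_le[OF square_integrable_diff assms(3)] assms(1,2,3)
    by (simp add: inner_L2_diff_left abs_minus_commute)
  show "(\<lambda>n. norm_L2 M (\<lambda>x. f x - s n x) * norm_L2 M g) \<longlonglongrightarrow> 0"
    using tendsto_mult_left_zero[OF lim] .
qed

subsection \<open>Completeness of \<open>L\<^sup>2\<close>\<close>

lemma AE_summable_norm:
  fixes f :: "nat \<Rightarrow> 'a \<Rightarrow> 'b::{banach, second_countable_topology}"
  assumes f: "\<And>k. integrable M (f k)" and summable: "summable (\<lambda>k. \<integral>x. norm (f k x) \<partial>M)"
  shows "AE x in M. summable (\<lambda>k. norm (f k x))"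
proof -
  have "(\<integral>\<^sup>+x. (\<Sum>k. ennreal (norm (f k x))) \<partial>M) = (\<Sum>k. \<integral>\<^sup>+x. ennreal (norm (f k x)) \<partial>M)"
    using f by (intro nn_integral_suminf) auto
  also have "\<dots> = (\<Sum>k. ennreal (\<integral>x. norm (f k x) \<partial>M))"
    using f by (intro suminf_cong nn_integral_eq_integral) auto
  also have "\<dots> = ennreal (\<Sum>k. \<integral>x. norm (f k x) \<partial>M)"
    using summable by (intro suminf_ennreal2) auto
  finally have "AE x in M. (\<Sum>k. ennreal (norm (f k x))) \<noteq> \<infinity>"
    using f by (intro nn_integral_noteq_infinite) auto
  then show ?thesis
    by eventually_elim (auto intro: summable_suminf_not_top)
qed

lemma AE_convergent_of_fast_Cauchy:
  assumes S: "\<And>k. square_integrable M (S k)"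
    and fast: "\<And>k. inner_L2 M (\<lambda>x. S (Suc k) x - S k x) (\<lambda>x. S (Suc k) x - S k x) \<le> (1/4)^k"
  shows "AE x in M. convergent (\<lambda>k. S k x)"
proof -
  define b where "b k x = S (Suc k) x - S k x" for k x
  have b: "integrable M (\<lambda>x. 2^k * (b k x)\<^sup>2)" for k
    using square_integrable_diff[OF S S, of "Suc k" k] by (simp add: b_def square_integrable_def)
  have norm_b: "(\<integral>x. norm (2^k * (b k x)\<^sup>2) \<partial>M) \<le> (1/2)^k" for k
  proof -
    have "(\<integral>x. norm (2^k * (b k x)\<^sup>2) \<partial>M) = 2^k * (\<integral>x. (b k x)\<^sup>2 \<partial>M)"
      by simp
    also have "\<dots> \<le> 2^k * (1/4)^k"
      using fast[of k] by (simp add: b_def inner_L2_def power2_eq_square)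
    finally show ?thesis by (simp flip: power_mult_distrib)
  qed
  have "AE x in M. summable (\<lambda>k. norm (2^k * (b k x)\<^sup>2))"
    using b
  proof (rule AE_summable_norm)
    show "summable (\<lambda>k. \<integral>x. norm (2^k * (b k x)\<^sup>2) \<partial>M)"
      by (rule summable_comparison_test'[OF summable_geometric[of "1/2"]]) (use norm_b in simp_all)
  qed
  then show ?thesis
  proof eventually_elim
    case (elim x)
    have "norm (b k x) \<le> (1/2)^k + norm (2^k * (b k x)\<^sup>2)" for k
      using abs_mult_le_sum_squares[of "sqrt ((1/2)^k)" "sqrt (2^k) * b k x"]
      by (simp add: power_mult_distrib real_sqrt_divide power_one_over flip: real_sqrt_mult)
    then have "summable (\<lambda>k. b k x)"
      by (intro summable_comparison_test'[OF summable_add[OF summable_geometric[of "1/2"] elim]]) auto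
    then have "convergent (\<lambda>n. S 0 x + (\<Sum>k<n. b k x))"
      by (simp add: convergent_add convergent_const summable_iff_convergent)
    then show ?case
      using sum_lessThan_telescope[of "\<lambda>k. S k x"] by (simp add: b_def)
  qed
qed

lemma square_integrable_AE_limit:
  assumes f: "\<And>k. square_integrable M (f k)" and g: "g \<in> borel_measurable M"
    and lim: "AE x in M. (\<lambda>k. f k x) \<longlonglongrightarrow> g x"
    and bound: "\<forall>\<^sub>F k in sequentially. inner_L2 M (f k) (f k) \<le> c"
  shows "square_integrable M g" and "inner_L2 M g g \<le> c"
proof -
  have "(\<integral>\<^sup>+x. ennreal ((g x)\<^sup>2) \<partial>M) = (\<integral>\<^sup>+x. liminf (\<lambda>k. ennreal ((f k x)\<^sup>2)) \<partial>M)"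
  proof (rule nn_integral_cong_AE)
    show "AE x in M. ennreal ((g x)\<^sup>2) = liminf (\<lambda>k. ennreal ((f k x)\<^sup>2))"
      using lim
    proof eventually_elim
      case (elim x)
      then have "(\<lambda>k. ennreal ((f k x)\<^sup>2)) \<longlonglongrightarrow> ennreal ((g x)\<^sup>2)"
        by (intro tendsto_ennrealI tendsto_power)
      then show ?case
        by (rule lim_imp_Liminf[OF sequentially_bot, symmetric])
    qed
  qed
  also have "\<dots> \<le> liminf (\<lambda>k. \<integral>\<^sup>+x. ennreal ((f k x)\<^sup>2) \<partial>M)"
    using f by (intro nn_integral_liminf) (auto simp: square_integrable_def)
  also have "\<dots> = liminf (\<lambda>k. ennreal (inner_L2 M (f k) (f k)))"
    by (simp only: nn_integral_square[OF f])
  also have "\<dots> \<le> liminf (\<lambda>k::nat. ennreal c)"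
    by (intro Liminf_mono eventually_mono[OF bound] ennreal_leI)
  finally have Fatou: "(\<integral>\<^sup>+x. ennreal ((g x)\<^sup>2) \<partial>M) \<le> ennreal c"
    by (simp add: Liminf_const)
  then have "(\<integral>\<^sup>+x. ennreal ((g x)\<^sup>2) \<partial>M) < \<infinity>"
    by (rule order_le_less_trans) simp
  then have "integrable M (\<lambda>x. (g x)\<^sup>2)"
    using g by (intro integrableI_nonneg borel_measurable_power) simp_all
  with g show sq: "square_integrable M g"
    by (simp add: square_integrable_def)
  obtain k where "inner_L2 M (f k) (f k) \<le> c"
    using bound by (auto simp: eventually_sequentially)
  then have "0 \<le> c"
    using inner_L2_self_nonneg order_trans by blast
  then show "inner_L2 M g g \<le> c"
    using Fatou by (simp add: nn_integral_square[OF sq])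
qed

definition L2_Cauchy :: "'a measure \<Rightarrow> (nat \<Rightarrow> 'a \<Rightarrow> real) \<Rightarrow> bool" where
  "L2_Cauchy M S \<longleftrightarrow> (\<forall>\<epsilon>>0. \<exists>N. \<forall>n\<ge>N. \<forall>m\<ge>n.
     inner_L2 M (\<lambda>x. S m x - S n x) (\<lambda>x. S m x - S n x) \<le> \<epsilon>)"

lemma L2_Cauchy_ex_fast_subsequence:
  assumes "L2_Cauchy M S"
  obtains r where "\<And>k. k \<le> r k"
    and "\<And>k. inner_L2 M (\<lambda>x. S (r (Suc k)) x - S (r k) x) (\<lambda>x. S (r (Suc k)) x - S (r k) x) \<le> (1/4)^k"
proof -
  let ?d = "\<lambda>m n. inner_L2 M (\<lambda>x. S m x - S n x) (\<lambda>x. S m x - S n x)"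
  have "\<forall>k. \<exists>N. \<forall>n\<ge>N. \<forall>m\<ge>n. ?d m n \<le> (1/4)^k"
    using assms by (simp add: L2_Cauchy_def)
  then obtain N where N: "\<forall>k. \<forall>n\<ge>N k. \<forall>m\<ge>n. ?d m n \<le> (1/4)^k"
    by (rule choice[THEN exE])
  define r where "r k = k + (\<Sum>i\<le>k. N i)" for k
  have "N k \<le> (\<Sum>i\<le>k. N i)" for k
    by (rule member_le_sum) auto
  then have r: "N k \<le> r k" "r k \<le> r (Suc k)" "k \<le> r k" for k
    by (simp_all add: r_def trans_le_add2)
  show ?thesis
    by (rule that[of r]) (use N r in blast)+
qed

lemma L2_Cauchy_tendsto_AE_subsequence_limit:
  assumes S: "\<And>n. square_integrable M (S n)" and Cauchy: "L2_Cauchy M S"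
    and w: "w \<in> borel_measurable M" and r: "\<And>k. k \<le> r k"
    and lim: "AE x in M. (\<lambda>k. S (r k) x) \<longlonglongrightarrow> w x"
  shows "square_integrable M w" and "(\<lambda>n. norm_L2 M (\<lambda>x. w x - S n x)) \<longlonglongrightarrow> 0"
proof -
  let ?d = "\<lambda>m n. inner_L2 M (\<lambda>x. S m x - S n x) (\<lambda>x. S m x - S n x)"
  have limit: "square_integrable M (\<lambda>x. w x - S n x)" "inner_L2 M (\<lambda>x. w x - S n x) (\<lambda>x. w x - S n x) \<le> \<epsilon>"
    if \<epsilon>: "\<forall>m\<ge>n. ?d m n \<le> \<epsilon>" for n \<epsilon>
  proof -
    have diff_lim: "AE x in M. (\<lambda>k. S (r k) x - S n x) \<longlonglongrightarrow> w x - S n x"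
      using lim by eventually_elim (intro tendsto_diff tendsto_const)
    have bound: "\<forall>\<^sub>F k in sequentially. ?d (r k) n \<le> \<epsilon>"
      using \<epsilon> r le_trans by (intro eventually_sequentiallyI[of n]) blast
    have meas: "(\<lambda>x. w x - S n x) \<in> borel_measurable M"
      by (intro borel_measurable_diff w square_integrable_measurable[OF S])
    show "square_integrable M (\<lambda>x. w x - S n x)"
      "inner_L2 M (\<lambda>x. w x - S n x) (\<lambda>x. w x - S n x) \<le> \<epsilon>"
      by (rule square_integrable_AE_limit[OF square_integrable_diff[OF S S] meas diff_lim bound])+
  qed
  obtain K where "\<forall>m\<ge>K. ?d m K \<le> 1"
    using Cauchy unfolding L2_Cauchy_def by (meson order_refl zero_less_one)
  from square_integrable_add[OF limit(1)[OF this] S[of K]] show "square_integrable M w" by simp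
  have "(\<lambda>n. inner_L2 M (\<lambda>x. w x - S n x) (\<lambda>x. w x - S n x)) \<longlonglongrightarrow> 0"
  proof (rule LIMSEQ_I)
    fix \<epsilon> :: real assume "0 < \<epsilon>"
    then have "0 < \<epsilon> / 2" by simp
    then obtain K where "\<forall>n\<ge>K. \<forall>m\<ge>n. ?d m n \<le> \<epsilon> / 2"
      using Cauchy unfolding L2_Cauchy_def by blast
    then have "\<forall>n\<ge>K. inner_L2 M (\<lambda>x. w x - S n x) (\<lambda>x. w x - S n x) \<le> \<epsilon> / 2"
      using limit(2) by blast
    then have "norm (inner_L2 M (\<lambda>x. w x - S n x) (\<lambda>x. w x - S n x) - 0) < \<epsilon>" if "K \<le> n" for n
      using that \<open>0 < \<epsilon>\<close> by (fastforce simp: inner_L2_self_nonneg)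
    then show "\<exists>K. \<forall>n\<ge>K. norm (inner_L2 M (\<lambda>x. w x - S n x) (\<lambda>x. w x - S n x) - 0) < \<epsilon>"
      by blast
  qed
  then show "(\<lambda>n. norm_L2 M (\<lambda>x. w x - S n x)) \<longlonglongrightarrow> 0"
    by (simp add: norm_L2_tendsto_zero_iff)
qed

theorem L2_complete:
  assumes S: "\<And>n. square_integrable M (S n)" and Cauchy: "L2_Cauchy M S"
  shows "\<exists>w. square_integrable M w \<and> (\<lambda>n. norm_L2 M (\<lambda>x. w x - S n x)) \<longlonglongrightarrow> 0"
proof -
  obtain r where r: "\<And>k. k \<le> r k"
    and fast: "\<And>k. inner_L2 M (\<lambda>x. S (r (Suc k)) x - S (r k) x) (\<lambda>x. S (r (Suc k)) x - S (r k) x) \<le> (1/4)^k"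
    using L2_Cauchy_ex_fast_subsequence[OF Cauchy] by blast
  define w where "w x = lim (\<lambda>k. S (r k) x)" for x
  have "w \<in> borel_measurable M"
    unfolding w_def by (intro borel_measurable_lim_metric square_integrable_measurable[OF S])
  moreover have "AE x in M. (\<lambda>k. S (r k) x) \<longlonglongrightarrow> w x"
    using AE_convergent_of_fast_Cauchy[OF S fast] by eventually_elim (simp add: w_def convergent_LIMSEQ_iff)
  ultimately show ?thesis
    using L2_Cauchy_tendsto_AE_subsequence_limit[OF S Cauchy _ r] by blast
qed

subsection \<open>Orthonormal systems and bases\<close>

locale orthonormal_system =
  fixes M :: "'a measure" and e :: "nat \<Rightarrow> 'a \<Rightarrow> real"
  assumes square_integrable_basis: "square_integrable M (e j)"
    and inner_basis: "inner_L2 M (e i) (e j) = (if i = j then 1 else 0)"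
begin

abbreviation coeff :: "('a \<Rightarrow> real) \<Rightarrow> nat \<Rightarrow> real" where
  "coeff v j \<equiv> inner_L2 M v (e j)"

lemma square_integrable_lincomb: "square_integrable M (\<lambda>x. \<Sum>j\<in>I. a j * e j x)"
  by (intro square_integrable_sum square_integrable_scale square_integrable_basis)

lemma inner_lincomb_left:
  "square_integrable M w \<Longrightarrow> inner_L2 M (\<lambda>x. \<Sum>j\<in>I. a j * e j x) w = (\<Sum>j\<in>I. a j * coeff w j)"
  by (simp add: inner_L2_sum_left square_integrable_scale square_integrable_basis inner_L2_scale_left
      inner_L2_commute[of M w])

lemma coeff_lincomb:
  "finite I \<Longrightarrow> coeff (\<lambda>x. \<Sum>j\<in>I. a j * e j x) k = (if k \<in> I then a k else 0)"
  by (simp add: inner_lincomb_left square_integrable_basis inner_basis if_distrib cong: if_cong)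

lemma inner_lincomb_self:
  "finite I \<Longrightarrow> inner_L2 M (\<lambda>x. \<Sum>j\<in>I. a j * e j x) (\<lambda>x. \<Sum>j\<in>I. a j * e j x) = (\<Sum>j\<in>I. (a j)\<^sup>2)"
  by (simp add: inner_lincomb_left square_integrable_lincomb coeff_lincomb power2_eq_square)

lemma inner_minus_projection_self:
  assumes "finite I" and v: "square_integrable M v"
  shows "inner_L2 M (\<lambda>x. v x - (\<Sum>j\<in>I. coeff v j * e j x)) (\<lambda>x. v x - (\<Sum>j\<in>I. coeff v j * e j x))
    = inner_L2 M v v - (\<Sum>j\<in>I. (coeff v j)\<^sup>2)"
proof -
  let ?P = "\<lambda>x. \<Sum>j\<in>I. coeff v j * e j x"
  have "inner_L2 M ?P v = (\<Sum>j\<in>I. (coeff v j)\<^sup>2)"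
    using v by (simp add: inner_lincomb_left power2_eq_square)
  moreover have "inner_L2 M ?P ?P = (\<Sum>j\<in>I. (coeff v j)\<^sup>2)"
    using assms by (simp add: inner_lincomb_self)
  ultimately show ?thesis
    using v square_integrable_lincomb[of "coeff v" I]
    by (simp add: inner_L2_diff_left inner_L2_diff_right square_integrable_diff inner_L2_commute[of M v ?P])
qed

lemma Bessel_inequality:
  assumes "finite I" "square_integrable M v"
  shows "(\<Sum>j\<in>I. (coeff v j)\<^sup>2) \<le> inner_L2 M v v"
  using inner_minus_projection_self[OF assms] inner_L2_self_nonneg[of M "\<lambda>x. v x - (\<Sum>j\<in>I. coeff v j * e j x)"]
  by simp

lemma abs_sum_coeff_mult_le:
  assumes "finite I" "square_integrable M v" "square_integrable M w"
  shows "\<bar>\<Sum>j\<in>I. coeff v j * coeff w j\<bar> \<le> inner_L2 M v v + inner_L2 M w w"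
proof -
  have "\<bar>\<Sum>j\<in>I. coeff v j * coeff w j\<bar> \<le> (\<Sum>j\<in>I. (coeff v j)\<^sup>2 + (coeff w j)\<^sup>2)"
    by (rule order_trans[OF sum_abs]) (intro sum_mono abs_mult_le_sum_squares)
  also have "\<dots> \<le> inner_L2 M v v + inner_L2 M w w"
    unfolding sum.distrib using assms by (intro add_mono Bessel_inequality)
  finally show ?thesis .
qed

theorem Riesz_Fischer:
  assumes a: "summable (\<lambda>j. (a j)\<^sup>2)"
  shows "\<exists>w. square_integrable M w \<and> (\<lambda>n. norm_L2 M (\<lambda>x. w x - (\<Sum>j<n. a j * e j x))) \<longlonglongrightarrow> 0"
proof (rule L2_complete)
  let ?S = "\<lambda>n x. \<Sum>j<n. a j * e j x"
  show "square_integrable M (?S n)" for n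
    by (rule square_integrable_lincomb)
  have dist: "inner_L2 M (\<lambda>x. ?S m x - ?S n x) (\<lambda>x. ?S m x - ?S n x) = (\<Sum>j\<in>{n..<m}. (a j)\<^sup>2)"
    if "n \<le> m" for m n
  proof -
    have "(\<lambda>x. ?S m x - ?S n x) = (\<lambda>x. \<Sum>j\<in>{n..<m}. a j * e j x)"
      using that by (simp add: sum_diff_nat_ivl[of 0 n m, unfolded atLeast0LessThan])
    then show ?thesis
      by (simp add: inner_lincomb_self)
  qed
  show "L2_Cauchy M ?S"
    unfolding L2_Cauchy_def
  proof (intro allI impI)
    fix \<epsilon> :: real assume "0 < \<epsilon>"
    then obtain N where "\<forall>n\<ge>N. \<forall>m. norm (\<Sum>j\<in>{n..<m}. (a j)\<^sup>2) < \<epsilon>"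
      using a unfolding summable_Cauchy by blast
    then have "\<forall>n\<ge>N. \<forall>m\<ge>n. (\<Sum>j\<in>{n..<m}. (a j)\<^sup>2) \<le> \<epsilon>"
      by (simp add: sum_nonneg less_imp_le)
    then show "\<exists>N. \<forall>n\<ge>N. \<forall>m\<ge>n.
        inner_L2 M (\<lambda>x. ?S m x - ?S n x) (\<lambda>x. ?S m x - ?S n x) \<le> \<epsilon>"
      by (auto simp: dist)
  qed
qed

end

locale orthonormal_basis = orthonormal_system +
  assumes expansion: "square_integrable M v \<Longrightarrow>
    (\<lambda>n. norm_L2 M (\<lambda>x. v x - (\<Sum>j<n. coeff v j * e j x))) \<longlonglongrightarrow> 0"
begin

lemma Parseval_identity:
  assumes v: "square_integrable M v"
  shows "(\<lambda>j. (coeff v j)\<^sup>2) sums inner_L2 M v v"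
proof -
  have "(\<lambda>n. inner_L2 M v v - (\<Sum>j<n. (coeff v j)\<^sup>2)) \<longlonglongrightarrow> 0"
    using expansion[OF v] v by (simp add: norm_L2_tendsto_zero_iff inner_minus_projection_self)
  from tendsto_diff[OF tendsto_const[of "inner_L2 M v v"] this] show ?thesis
    by (simp add: sums_def)
qed

lemma Parseval:
  assumes v: "square_integrable M v" and w: "square_integrable M w"
  shows "(\<lambda>j. coeff v j * coeff w j) sums inner_L2 M v w"
proof -
  let ?s = "\<lambda>x. v x + w x"
  have "(\<lambda>j. ((coeff ?s j)\<^sup>2 - (coeff v j)\<^sup>2 - (coeff w j)\<^sup>2) / 2)
      sums ((inner_L2 M ?s ?s - inner_L2 M v v - inner_L2 M w w) / 2)"
    by (intro sums_divide sums_diff Parseval_identity square_integrable_add v w)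
  then show ?thesis
    using v w
    by (simp add: inner_L2_add_left inner_L2_add_right square_integrable_add square_integrable_basis
        inner_L2_commute[of M w v] power2_sum)
qed

end

subsection \<open>Complete measures\<close>

context complete_measure
begin

lemma borel_measurable_cong_AE:
  assumes f: "f \<in> borel_measurable M" and eq: "AE x in M. f x = g x"
  shows "g \<in> borel_measurable M"
proof (rule measurableI)
  fix A :: "'b set" assume "A \<in> sets borel"
  with f have vimage_f: "f -` A \<inter> space M \<in> sets M"
    by (rule measurable_sets)
  have "AE x in M. x \<in> f -` A \<inter> space M \<longleftrightarrow> x \<in> g -` A \<inter> space M"
    using eq by eventually_elim simp
  from in_sets_AE[OF this vimage_f] show "g -` A \<inter> space M \<in> sets M"
    by blast
qed simp

lemma square_integrable_cong_AE:
  assumes "square_integrable M f" and eq: "AE x in M. f x = g x"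
  shows "square_integrable M g"
  using assms(1)
proof (rule square_integrable_bound)
  show "g \<in> borel_measurable M"
    by (rule borel_measurable_cong_AE[OF square_integrable_measurable[OF assms(1)] eq])
  show "AE x in M. \<bar>g x\<bar> \<le> \<bar>f x\<bar>"
    using eq by eventually_elim simp
qed

text \<open>No measurability is required: in a complete measure space \<open>f\<close> and \<open>g\<close> are measurable together,
  and a non-measurable function has integral \<open>0\<close>.\<close>
lemma integral_cong_AE_complete:
  fixes f g :: "'a \<Rightarrow> 'b::{banach, second_countable_topology}"
  assumes eq: "AE x in M. f x = g x"
  shows "integral\<^sup>L M f = integral\<^sup>L M g"
proof (cases "f \<in> borel_measurable M")
  case True
  then show ?thesis
    by (intro integral_cong_AE borel_measurable_cong_AE[OF True eq] eq)
next
  case False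
  have "AE x in M. g x = f x"
    using eq by eventually_elim simp
  then have "g \<notin> borel_measurable M"
    using False borel_measurable_cong_AE by blast
  then show ?thesis
    using False by (metis borel_measurable_integrable not_integrable_integral_eq)
qed

lemma inner_L2_cong_AE:
  assumes f: "AE x in M. f x = f' x" and g: "AE x in M. g x = g' x"
  shows "inner_L2 M f g = inner_L2 M f' g'"
  unfolding inner_L2_def
proof (rule integral_cong_AE_complete)
  show "AE x in M. f x * g x = f' x * g' x"
    using f g by eventually_elim simp
qed

end

lemma complete_measure_restrict_space:
  assumes "complete_measure M" and S: "S \<in> sets M"
  shows "complete_measure (restrict_space M S)"
proof (rule complete_measure.intro)
  interpret complete_measure M by fact
  fix A B assume "B \<subseteq> A" and A: "A \<in> null_sets (restrict_space M S)"
  then have "A \<in> null_sets M" "B \<subseteq> S"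
    using S by (simp_all add: null_sets_restrict_space subset_trans)
  with \<open>B \<subseteq> A\<close> have "B \<in> sets M" "B \<subseteq> S"
    using complete by blast+
  then show "B \<in> sets (restrict_space M S)"
    using S by (simp add: sets_restrict_space_iff)
qed

subsection \<open>Square-integrable functions on a product\<close>

context pair_sigma_finite
begin

lemma AE_pair_snd:
  assumes "AE z in M1 \<Otimes>\<^sub>M M2. P z"
  shows "AE y in M2. AE x in M1. P (x, y)"
proof -
  interpret swapped: pair_sigma_finite M2 M1 ..
  have "AE z in distr (M2 \<Otimes>\<^sub>M M1) (M1 \<Otimes>\<^sub>M M2) (\<lambda>(x, y). (y, x)). P z"
    using assms by (subst distr_pair_swap[symmetric])
  then have "AE z in M2 \<Otimes>\<^sub>M M1. P (case z of (x, y) \<Rightarrow> (y, x))"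
    by (rule AE_distrD[OF measurable_pair_swap'])
  from swapped.AE_pair[OF this] show ?thesis by simp
qed

lemma AE_square_integrable_slice:
  assumes "square_integrable (M1 \<Otimes>\<^sub>M M2) (case_prod p)"
  shows "AE t in M1. square_integrable M2 (p t)"
proof -
  have meas: "case_prod p \<in> borel_measurable (M1 \<Otimes>\<^sub>M M2)"
    and int: "integrable (M1 \<Otimes>\<^sub>M M2) (\<lambda>(t, x). (p t x)\<^sup>2)"
    using assms by (simp_all add: square_integrable_def case_prod_beta')
  show ?thesis
    using AE_integrable_fst[OF int] AE_space
  proof eventually_elim
    case (elim t)
    then show ?case
      using measurable_compose[OF measurable_Pair1' meas] by (simp add: square_integrable_def)
  qed
qed

lemma
  assumes p: "square_integrable (M1 \<Otimes>\<^sub>M M2) (case_prod p)"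
    and q: "square_integrable (M1 \<Otimes>\<^sub>M M2) (case_prod q)"
  shows integrable_inner_L2_slices: "integrable M1 (\<lambda>t. inner_L2 M2 (p t) (q t))"
    and integral_inner_L2_slices:
      "(\<integral>t. inner_L2 M2 (p t) (q t) \<partial>M1) = inner_L2 (M1 \<Otimes>\<^sub>M M2) (case_prod p) (case_prod q)"
proof -
  have int: "integrable (M1 \<Otimes>\<^sub>M M2) (\<lambda>(t, x). p t x * q t x)"
    using integrable_mult_square_integrable[OF p q] by (simp add: case_prod_beta')
  show "integrable M1 (\<lambda>t. inner_L2 M2 (p t) (q t))"
    unfolding inner_L2_def by (rule integrable_fst[OF int])
  show "(\<integral>t. inner_L2 M2 (p t) (q t) \<partial>M1) = inner_L2 (M1 \<Otimes>\<^sub>M M2) (case_prod p) (case_prod q)"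
    using integral_fst[OF int] by (simp add: inner_L2_def case_prod_beta')
qed

lemma square_integrable_constant_path:
  assumes "finite_measure M1" and w: "square_integrable M2 w"
  shows "square_integrable (M1 \<Otimes>\<^sub>M M2) (\<lambda>(t, x). w x)"
proof -
  interpret M1: finite_measure M1 by fact
  have [measurable]: "w \<in> borel_measurable M2"
    by (rule square_integrable_measurable[OF w])
  have "integrable (M1 \<Otimes>\<^sub>M M2) (\<lambda>(t, x). (w x)\<^sup>2)"
    using w by (intro Fubini_integrable) (auto simp: square_integrable_def)
  then show ?thesis
    by (simp add: square_integrable_def case_prod_beta')
qed

end

lemma (in orthonormal_basis) Parseval_integral:
  assumes "pair_sigma_finite N M"
    and p: "square_integrable (N \<Otimes>\<^sub>M M) (case_prod p)"
    and q: "square_integrable (N \<Otimes>\<^sub>M M) (case_prod q)"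
  shows "(\<lambda>j. \<integral>s. coeff (p s) j * coeff (q s) j \<partial>N) sums (\<integral>s. inner_L2 M (p s) (q s) \<partial>N)"
proof -
  interpret pair_sigma_finite N M by fact
  let ?c = "\<lambda>j s. coeff (p s) j * coeff (q s) j"
  let ?w = "\<lambda>s. inner_L2 M (p s) (p s) + inner_L2 M (q s) (q s)"
  have [measurable]: "case_prod p \<in> borel_measurable (N \<Otimes>\<^sub>M M)" "case_prod q \<in> borel_measurable (N \<Otimes>\<^sub>M M)"
    "e j \<in> borel_measurable M" for j
    by (rule square_integrable_measurable[OF p] square_integrable_measurable[OF q]
        square_integrable_measurable[OF square_integrable_basis])+
  have [measurable]: "?c j \<in> borel_measurable N" for j
    unfolding inner_L2_def by measurable
  have slices: "AE s in N. square_integrable M (p s) \<and> square_integrable M (q s)"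
    using AE_square_integrable_slice[OF p] AE_square_integrable_slice[OF q] by eventually_elim simp
  have w: "integrable N ?w"
    by (intro Bochner_Integration.integrable_add integrable_inner_L2_slices p q)
  have bound: "AE s in N. norm (\<Sum>j\<in>I. ?c j s) \<le> ?w s" if "finite I" for I
    using slices by eventually_elim (simp add: abs_sum_coeff_mult_le that)
  have c: "integrable N (?c j)" for j
  proof (rule Bochner_Integration.integrable_bound[OF w])
    show "AE s in N. norm (?c j s) \<le> norm (?w s)"
      using bound[of "{j}"] by (auto simp: inner_L2_self_nonneg elim: eventually_mono)
  qed measurable
  have "(\<lambda>n. \<integral>s. (\<Sum>j<n. ?c j s) \<partial>N) \<longlonglongrightarrow> (\<integral>s. inner_L2 M (p s) (q s) \<partial>N)"
  proof (rule integral_dominated_convergence[where w = ?w])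
    show "AE s in N. (\<lambda>n. \<Sum>j<n. ?c j s) \<longlonglongrightarrow> inner_L2 M (p s) (q s)"
      using slices by eventually_elim (use Parseval in \<open>simp add: sums_def\<close>)
  qed (use bound w integrable_inner_L2_slices[OF p q] in auto)
  then show ?thesis
    by (simp add: sums_def c)
qed

subsection \<open>Primitives of square-integrable paths\<close>

locale finite_diffuse_measure = finite_measure N for N :: "real measure" +
  assumes measurable_ident [measurable]: "(\<lambda>s. s) \<in> borel_measurable N"
    and diffuse: "AE s in N. s \<noteq> r"
begin

lemma set_integrable_atMost:
  fixes g :: "real \<Rightarrow> real"
  assumes "integrable N g"
  shows "set_integrable N {..t} g"
  unfolding set_integrable_def
  by (rule Bochner_Integration.integrable_bound[OF assms]) (use assms in \<open>auto simp: indicator_def\<close>)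

lemma AE_pair_neq: "AE z in N \<Otimes>\<^sub>M N. fst z \<noteq> snd z"
proof -
  interpret NN: pair_sigma_finite N N ..
  show ?thesis
  proof (rule NN.AE_pair_measure)
    show "{z \<in> space (N \<Otimes>\<^sub>M N). fst z \<noteq> snd z} \<in> sets (N \<Otimes>\<^sub>M N)"
      by measurable
    show "AE r in N. AE s in N. fst (r, s) \<noteq> snd (r, s)"
      using diffuse by (simp add: eq_commute)
  qed
qed

lemma set_integral_atMost_le_integral:
  fixes g :: "real \<Rightarrow> real"
  assumes "integrable N g" "\<And>s. 0 \<le> g s"
  shows "(LINT s:{..t}|N. g s) \<le> (\<integral>s. g s \<partial>N)"
  unfolding set_lebesgue_integral_def
  using assms set_integrable_atMost[OF assms(1)]
  by (intro integral_mono) (auto simp: set_integrable_def indicator_def)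

definition triangle :: "(real \<Rightarrow> real) \<Rightarrow> real \<times> real \<Rightarrow> real" where
  "triangle h z = (if fst z \<le> snd z then h (fst z) * h (snd z) else 0)"

lemma
  assumes h: "integrable N h"
  shows integrable_square: "integrable (N \<Otimes>\<^sub>M N) (\<lambda>z. h (fst z) * h (snd z))"
    and integrable_triangle: "integrable (N \<Otimes>\<^sub>M N) (triangle h)"
    and integral_triangle: "integral\<^sup>L (N \<Otimes>\<^sub>M N) (triangle h) = (\<integral>s. h s * (LINT r:{..s}|N. h r) \<partial>N)"
proof -
  interpret NN: pair_sigma_finite N N ..
  have [measurable]: "h \<in> borel_measurable N"
    using h by auto
  show square: "integrable (N \<Otimes>\<^sub>M N) (\<lambda>z. h (fst z) * h (snd z))"
    using h by (intro NN.Fubini_integrable) (auto simp: abs_mult)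
  show triangle: "integrable (N \<Otimes>\<^sub>M N) (triangle h)"
    by (rule Bochner_Integration.integrable_bound[OF square]) (auto simp: triangle_def[abs_def])
  have "integral\<^sup>L (N \<Otimes>\<^sub>M N) (triangle h) = (\<integral>s. \<integral>r. triangle h (r, s) \<partial>N \<partial>N)"
    using NN.integral_snd[of "\<lambda>r s. triangle h (r, s)"] triangle by simp
  also have "\<dots> = (\<integral>s. h s * (LINT r:{..s}|N. h r) \<partial>N)"
  proof (rule Bochner_Integration.integral_cong[OF refl])
    fix s
    have "triangle h (r, s) = h s * (indicator {..s} r *\<^sub>R h r)" for r
      by (simp add: triangle_def indicator_def)
    then show "(\<integral>r. triangle h (r, s) \<partial>N) = h s * (LINT r:{..s}|N. h r)"
      by (simp add: set_lebesgue_integral_def)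
  qed
  finally show "integral\<^sup>L (N \<Otimes>\<^sub>M N) (triangle h) = (\<integral>s. h s * (LINT r:{..s}|N. h r) \<partial>N)" .
qed

text \<open>The square splits along its diagonal into two triangles, on which the symmetric integrand
  has the same integral.\<close>
lemma square_integral_eq_triangle:
  fixes h :: "real \<Rightarrow> real"
  assumes h: "integrable N h"
  shows "(\<integral>s. h s \<partial>N)\<^sup>2 = 2 * integral\<^sup>L (N \<Otimes>\<^sub>M N) (triangle h)"
proof -
  interpret NN: pair_sigma_finite N N ..
  have [measurable]: "h \<in> borel_measurable N"
    using h by auto
  note triangle = integrable_triangle[OF h]
  have "(\<integral>s. h s \<partial>N)\<^sup>2 = (\<integral>r. \<integral>s. h r * h s \<partial>N \<partial>N)"
    by (simp add: power2_eq_square)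
  also have "\<dots> = (\<integral>z. h (fst z) * h (snd z) \<partial>(N \<Otimes>\<^sub>M N))"
    using NN.integral_fst'[OF integrable_square[OF h]] by simp
  also have "\<dots> = (\<integral>z. triangle h z + (case z of (r, s) \<Rightarrow> triangle h (s, r)) \<partial>(N \<Otimes>\<^sub>M N))"
  proof (rule integral_cong_AE)
    show "AE z in N \<Otimes>\<^sub>M N. h (fst z) * h (snd z) = triangle h z + (case z of (r, s) \<Rightarrow> triangle h (s, r))"
      using AE_pair_neq by eventually_elim (auto simp: triangle_def)
  qed (auto simp: triangle_def[abs_def])
  also have "\<dots> = 2 * integral\<^sup>L (N \<Otimes>\<^sub>M N) (triangle h)"
    using triangle NN.integrable_product_swap[OF triangle] NN.integral_product_swap[of "triangle h"] by simp
  finally show ?thesis .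
qed

lemma integral_mult_primitive:
  fixes g :: "real \<Rightarrow> real"
  assumes g: "integrable N g"
  shows "(LINT s:{..t}|N. g s * (LINT r:{..s}|N. g r)) = (LINT s:{..t}|N. g s)\<^sup>2 / 2"
proof -
  define h where "h s = indicator {..t} s * g s" for s
  have h: "integrable N h"
    using set_integrable_atMost[OF g] by (simp add: h_def[abs_def] set_integrable_def)
  have "h s * (LINT r:{..s}|N. h r) = indicator {..t} s *\<^sub>R (g s * (LINT r:{..s}|N. g r))" for s
  proof (cases "s \<le> t")
    case True
    then have "(LINT r:{..s}|N. h r) = (LINT r:{..s}|N. g r)"
      unfolding set_lebesgue_integral_def
      by (intro Bochner_Integration.integral_cong) (auto simp: h_def indicator_def)
    with True show ?thesis by (simp add: h_def)
  qed (simp add: h_def)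
  then have "(LINT s:{..t}|N. g s * (LINT r:{..s}|N. g r)) = integral\<^sup>L (N \<Otimes>\<^sub>M N) (triangle h)"
    by (simp add: integral_triangle[OF h] set_lebesgue_integral_def)
  also have "\<dots> = (\<integral>s. h s \<partial>N)\<^sup>2 / 2"
    by (simp add: square_integral_eq_triangle[OF h])
  finally show ?thesis
    by (simp add: h_def set_lebesgue_integral_def)
qed

end

locale L2_evolution = finite_diffuse_measure N + pair_sigma_finite N M + orthonormal_basis M e
  for N :: "real measure" and M :: "'a measure" and e :: "nat \<Rightarrow> 'a \<Rightarrow> real"
begin

abbreviation L2_path :: "(real \<Rightarrow> 'a \<Rightarrow> real) \<Rightarrow> bool" where
  "L2_path \<psi> \<equiv> square_integrable (N \<Otimes>\<^sub>M M) (case_prod \<psi>)"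

definition primitive :: "(real \<Rightarrow> 'a \<Rightarrow> real) \<Rightarrow> real \<Rightarrow> 'a \<Rightarrow> real" where
  "primitive \<psi> t x = (LINT s:{..t}|N. \<psi> s x)"

lemma measurable_primitive:
  assumes [measurable]: "case_prod \<psi> \<in> borel_measurable (N \<Otimes>\<^sub>M M)"
  shows "primitive \<psi> t \<in> borel_measurable M"
    and "case_prod (primitive \<psi>) \<in> borel_measurable (N \<Otimes>\<^sub>M M)"
proof -
  show "primitive \<psi> t \<in> borel_measurable M"
    unfolding primitive_def[abs_def] set_lebesgue_integral_def by measurable
  have "(\<lambda>z. \<integral>s. (if s \<le> fst z then \<psi> s (snd z) else 0) \<partial>N) \<in> borel_measurable (N \<Otimes>\<^sub>M M)"
    by measurable
  also have "(\<lambda>z. \<integral>s. (if s \<le> fst z then \<psi> s (snd z) else 0) \<partial>N) = case_prod (primitive \<psi>)"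
    by (auto simp: fun_eq_iff primitive_def set_lebesgue_integral_def indicator_def
        intro!: Bochner_Integration.integral_cong)
  finally show "case_prod (primitive \<psi>) \<in> borel_measurable (N \<Otimes>\<^sub>M M)" .
qed

lemma AE_primitive_square_le:
  assumes \<psi>: "L2_path \<psi>"
  shows "AE x in M. (primitive \<psi> t x)\<^sup>2 \<le> measure N (space N) * (\<integral>s. (\<psi> s x)\<^sup>2 \<partial>N)"
proof -
  have [measurable]: "case_prod \<psi> \<in> borel_measurable (N \<Otimes>\<^sub>M M)"
    by (rule square_integrable_measurable[OF \<psi>])
  have "integrable (N \<Otimes>\<^sub>M M) (\<lambda>(s, x). (\<psi> s x)\<^sup>2)"
    using \<psi> by (simp add: square_integrable_def case_prod_beta')
  from AE_integrable_snd[OF this] AE_space show ?thesis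
  proof eventually_elim
    case (elim x)
    let ?i = "indicator {..t} :: real \<Rightarrow> real"
    have "(\<lambda>s. \<psi> s x) \<in> borel_measurable N"
      using elim(2) by measurable
    with elim(1) have \<psi>x: "square_integrable N (\<lambda>s. \<psi> s x)"
      by (simp add: square_integrable_def)
    have i: "square_integrable N ?i"
      by (rule square_integrable_bound[OF square_integrable_const[of 1]]) (auto simp: indicator_def)
    have "inner_L2 N ?i ?i \<le> (\<integral>s. 1 \<partial>N)"
      unfolding inner_L2_def
      by (intro integral_mono integrable_mult_square_integrable i) (auto simp: indicator_def)
    then have norm_i: "inner_L2 N ?i ?i \<le> measure N (space N)" by simp
    have "(primitive \<psi> t x)\<^sup>2 = (inner_L2 N ?i (\<lambda>s. \<psi> s x))\<^sup>2"
      by (simp add: primitive_def set_lebesgue_integral_def inner_L2_def)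
    also have "\<dots> \<le> (norm_L2 N ?i * norm_L2 N (\<lambda>s. \<psi> s x))\<^sup>2"
      using abs_inner_L2_le[OF i \<psi>x] by (rule abs_le_square_iff[THEN iffD1, OF order_trans]) simp
    also have "\<dots> \<le> measure N (space N) * inner_L2 N (\<lambda>s. \<psi> s x) (\<lambda>s. \<psi> s x)"
      using norm_i by (simp add: power_mult_distrib norm_L2_square mult_right_mono inner_L2_self_nonneg)
    finally show ?case by (simp add: inner_L2_def power2_eq_square)
  qed
qed

lemma
  assumes \<psi>: "L2_path \<psi>"
  shows square_integrable_primitive: "square_integrable M (primitive \<psi> t)"
    and inner_primitive_self_le: "inner_L2 M (primitive \<psi> t) (primitive \<psi> t)
      \<le> measure N (space N) * inner_L2 (N \<Otimes>\<^sub>M M) (case_prod \<psi>) (case_prod \<psi>)"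
proof -
  have int: "integrable (N \<Otimes>\<^sub>M M) (\<lambda>(s, x). (\<psi> s x)\<^sup>2)"
    using \<psi> by (simp add: square_integrable_def case_prod_beta')
  let ?h = "\<lambda>x. measure N (space N) * (\<integral>s. (\<psi> s x)\<^sup>2 \<partial>N)"
  have h: "integrable M ?h"
    using integrable_snd[OF int] by (rule integrable_mult_right)
  have meas: "primitive \<psi> t \<in> borel_measurable M"
    by (rule measurable_primitive(1)[OF square_integrable_measurable[OF \<psi>]])
  have square: "integrable M (\<lambda>x. (primitive \<psi> t x)\<^sup>2)"
  proof (rule Bochner_Integration.integrable_bound[OF h])
    show "AE x in M. norm ((primitive \<psi> t x)\<^sup>2) \<le> norm (?h x)"
      using AE_primitive_square_le[OF \<psi>, of t] by eventually_elim simp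
  qed (use meas in simp)
  then show "square_integrable M (primitive \<psi> t)"
    using meas by (simp add: square_integrable_def)
  have "inner_L2 M (primitive \<psi> t) (primitive \<psi> t) \<le> integral\<^sup>L M ?h"
    using integral_mono_AE[OF square h AE_primitive_square_le[OF \<psi>]]
    by (simp add: inner_L2_def power2_eq_square)
  also have "\<dots> = measure N (space N) * inner_L2 (N \<Otimes>\<^sub>M M) (case_prod \<psi>) (case_prod \<psi>)"
    using integral_snd[OF int] by (simp add: inner_L2_def power2_eq_square case_prod_beta')
  finally show "inner_L2 M (primitive \<psi> t) (primitive \<psi> t)
      \<le> measure N (space N) * inner_L2 (N \<Otimes>\<^sub>M M) (case_prod \<psi>) (case_prod \<psi>)" .
qed

lemma L2_path_primitive:
  assumes \<psi>: "L2_path \<psi>"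
  shows "L2_path (primitive \<psi>)"
proof -
  let ?\<phi> = "primitive \<psi>"
  have [measurable]: "case_prod ?\<phi> \<in> borel_measurable (N \<Otimes>\<^sub>M M)"
    by (rule measurable_primitive(2)[OF square_integrable_measurable[OF \<psi>]])
  have "integrable N (\<lambda>t. inner_L2 M (?\<phi> t) (?\<phi> t))"
  proof (rule integrable_const_bound)
    show "AE t in N. norm (inner_L2 M (?\<phi> t) (?\<phi> t))
        \<le> measure N (space N) * inner_L2 (N \<Otimes>\<^sub>M M) (case_prod \<psi>) (case_prod \<psi>)"
      using inner_primitive_self_le[OF \<psi>] by (simp add: inner_L2_self_nonneg)
  qed (unfold inner_L2_def, measurable)
  then have "integrable (N \<Otimes>\<^sub>M M) (\<lambda>(t, x). (?\<phi> t x)\<^sup>2)"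
    using square_integrable_primitive[OF \<psi>]
    by (intro Fubini_integrable) (auto simp: square_integrable_def inner_L2_def power2_eq_square)
  then show ?thesis
    by (simp add: square_integrable_def case_prod_beta')
qed

lemma integrable_inner_constant:
  assumes "L2_path \<psi>" "square_integrable M w"
  shows "integrable N (\<lambda>s. inner_L2 M (\<psi> s) w)"
  by (rule integrable_inner_L2_slices[OF assms(1)
        square_integrable_constant_path[OF finite_measure_axioms assms(2)]])

lemma inner_primitive:
  assumes \<psi>: "L2_path \<psi>" and w: "square_integrable M w"
  shows "inner_L2 M (primitive \<psi> t) w = (LINT s:{..t}|N. inner_L2 M (\<psi> s) w)"
proof -
  have [measurable]: "case_prod \<psi> \<in> borel_measurable (N \<Otimes>\<^sub>M M)" "w \<in> borel_measurable M"
    by (rule square_integrable_measurable[OF \<psi>] square_integrable_measurable[OF w])+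
  have prod: "integrable (N \<Otimes>\<^sub>M M) (\<lambda>(s, x). \<psi> s x * w x)"
    using integrable_mult_square_integrable[OF \<psi> square_integrable_constant_path[OF finite_measure_axioms w]]
    by (simp add: case_prod_beta')
  have int: "integrable (N \<Otimes>\<^sub>M M) (\<lambda>(s, x). indicator {..t} s * (\<psi> s x * w x))"
    by (rule Bochner_Integration.integrable_bound[OF prod]) (auto simp: indicator_def)
  have "inner_L2 M (primitive \<psi> t) w = (\<integral>x. \<integral>s. indicator {..t} s * (\<psi> s x * w x) \<partial>N \<partial>M)"
    by (simp add: inner_L2_def primitive_def set_lebesgue_integral_def mult.assoc
        flip: integral_mult_left_zero)
  also have "\<dots> = (\<integral>s. \<integral>x. indicator {..t} s * (\<psi> s x * w x) \<partial>M \<partial>N)"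
    by (rule Fubini_integral[OF int])
  also have "\<dots> = (LINT s:{..t}|N. inner_L2 M (\<psi> s) w)"
    by (simp add: inner_L2_def set_lebesgue_integral_def)
  finally show ?thesis .
qed

lemma Parseval_set_integral:
  assumes p: "L2_path p" and q: "L2_path q"
  shows "(\<lambda>j. LINT s:{..t}|N. coeff (p s) j * coeff (q s) j) sums (LINT s:{..t}|N. inner_L2 M (p s) (q s))"
proof -
  have [measurable]: "case_prod q \<in> borel_measurable (N \<Otimes>\<^sub>M M)"
    by (rule square_integrable_measurable[OF q])
  have "L2_path (\<lambda>s x. indicator {..t} s * q s x)"
    by (rule square_integrable_bound[OF q]) (auto simp: indicator_def)
  from Parseval_integral[OF pair_sigma_finite_axioms p this] show ?thesis
    by (simp add: set_lebesgue_integral_def inner_L2_scale_left inner_L2_scale_right mult.left_commute)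
qed

lemma integral_coeff_mult_primitive:
  assumes \<psi>: "L2_path \<psi>"
  shows "(LINT s:{..t}|N. coeff (\<psi> s) j * coeff (primitive \<psi> s) j) = (coeff (primitive \<psi> t) j)\<^sup>2 / 2"
  unfolding inner_primitive[OF \<psi> square_integrable_basis]
  by (rule integral_mult_primitive[OF integrable_inner_constant[OF \<psi> square_integrable_basis]])

lemma energy_identity:
  assumes \<psi>: "L2_path \<psi>"
  shows "(LINT s:{..t}|N. inner_L2 M (\<psi> s) (primitive \<psi> s)) = inner_L2 M (primitive \<psi> t) (primitive \<psi> t) / 2"
proof (rule sums_unique2)
  show "(\<lambda>j. (coeff (primitive \<psi> t) j)\<^sup>2 / 2) sums (LINT s:{..t}|N. inner_L2 M (\<psi> s) (primitive \<psi> s))"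
    using Parseval_set_integral[OF \<psi> L2_path_primitive[OF \<psi>]]
    by (simp add: integral_coeff_mult_primitive[OF \<psi>])
  show "(\<lambda>j. (coeff (primitive \<psi> t) j)\<^sup>2 / 2) sums (inner_L2 M (primitive \<psi> t) (primitive \<psi> t) / 2)"
    by (intro sums_divide Parseval_identity square_integrable_primitive \<psi>)
qed

lemma integral_coeff_potential_nonpos:
  assumes \<psi>: "L2_path \<psi>" and \<mu>: "L2_path \<mu>" and "0 \<le> c"
    and evolution: "AE s in N. coeff (\<psi> s) j + c * coeff (\<mu> s) j = 0"
  shows "(LINT s:{..t}|N. coeff (\<mu> s) j * coeff (primitive \<psi> s) j) \<le> 0"
proof (cases "c = 0")
  case True
  have "coeff (primitive \<psi> s) j = 0" for s
  proof -
    have "AE r in N. indicator {..s} r *\<^sub>R coeff (\<psi> r) j = 0"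
      using evolution by eventually_elim (simp add: True)
    then show ?thesis
      by (simp add: inner_primitive[OF \<psi> square_integrable_basis] set_lebesgue_integral_def
          integral_eq_zero_AE)
  qed
  then show ?thesis by (simp add: set_lebesgue_integral_def)
next
  case False
  note int = integrable_inner_constant[OF _ square_integrable_basis, THEN borel_measurable_integrable]
  note [measurable] = int[OF \<psi>] int[OF \<mu>] int[OF L2_path_primitive[OF \<psi>]]
  have "c * (LINT s:{..t}|N. coeff (\<mu> s) j * coeff (primitive \<psi> s) j)
      = (LINT s:{..t}|N. c * (coeff (\<mu> s) j * coeff (primitive \<psi> s) j))"
    by simp
  also have "\<dots> = (LINT s:{..t}|N. (-1) * (coeff (\<psi> s) j * coeff (primitive \<psi> s) j))"
    unfolding set_lebesgue_integral_def
  proof (rule integral_cong_AE)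
    show "AE s in N. indicator {..t} s *\<^sub>R (c * (coeff (\<mu> s) j * coeff (primitive \<psi> s) j))
        = indicator {..t} s *\<^sub>R ((-1) * (coeff (\<psi> s) j * coeff (primitive \<psi> s) j))"
      using evolution
    proof eventually_elim
      case (elim s)
      then have "c * coeff (\<mu> s) j = - coeff (\<psi> s) j" by simp
      then show ?case by (simp flip: mult.assoc)
    qed
  qed measurable
  also have "\<dots> = - ((coeff (primitive \<psi> t) j)\<^sup>2 / 2)"
    unfolding set_integral_mult_right integral_coeff_mult_primitive[OF \<psi>] by simp
  finally have "c * (LINT s:{..t}|N. coeff (\<mu> s) j * coeff (primitive \<psi> s) j) \<le> 0" by simp
  then show ?thesis
    using False \<open>0 \<le> c\<close> by (simp add: mult_le_0_iff)
qed

text \<open>Componentwise, this is the evolution equation, integrated in time and tested with \<open>\<mu>\<close>.\<close>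
lemma integral_potential_nonpos:
  assumes \<psi>: "L2_path \<psi>" and \<mu>: "L2_path \<mu>" and c: "\<And>j. 0 \<le> c j"
    and evolution: "AE s in N. \<forall>j. coeff (\<psi> s) j + c j * coeff (\<mu> s) j = 0"
  shows "(LINT s:{..t}|N. inner_L2 M (\<mu> s) (primitive \<psi> s)) \<le> 0"
proof (rule sums_le[OF _ Parseval_set_integral[OF \<mu> L2_path_primitive[OF \<psi>]] sums_zero])
  show "(LINT s:{..t}|N. coeff (\<mu> s) j * coeff (primitive \<psi> s) j) \<le> 0" for j
    using evolution by (intro integral_coeff_potential_nonpos[OF \<psi> \<mu> c]) (auto elim: eventually_mono)
qed

lemma energy_inequality:
  assumes \<psi>: "L2_path \<psi>" and \<mu>: "L2_path \<mu>" and f: "L2_path f" and c: "\<And>j. 0 \<le> c j"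
    and evolution: "AE s in N. \<forall>j. coeff (\<psi> s) j + c j * coeff (\<mu> s) j = 0"
    and dissipation: "AE s in N. \<tau> * inner_L2 M (\<psi> s) (primitive \<psi> s)
      \<le> inner_L2 M (\<mu> s) (primitive \<psi> s) + inner_L2 M (f s) (primitive \<psi> s)
        + L * inner_L2 M (primitive \<psi> s) (primitive \<psi> s)"
  shows "\<tau> * inner_L2 M (primitive \<psi> t) (primitive \<psi> t)
    \<le> (\<integral>s. inner_L2 M (f s) (f s) \<partial>N)
      + (2 * L + 1) * (LINT s:{..t}|N. inner_L2 M (primitive \<psi> s) (primitive \<psi> s))"
proof -
  let ?\<phi> = "primitive \<psi>"
  have \<phi>: "L2_path ?\<phi>" by (rule L2_path_primitive[OF \<psi>])
  have int: "set_integrable N {..t} (\<lambda>s. inner_L2 M (p s) (q s))" if "L2_path p" "L2_path q" for p q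
    by (rule set_integrable_atMost[OF integrable_inner_L2_slices[OF that]])
  note ints = int[OF \<psi> \<phi>] int[OF \<mu> \<phi>] int[OF f f] int[OF \<phi> \<phi>]
  have "\<tau> * inner_L2 M (?\<phi> t) (?\<phi> t) = (LINT s:{..t}|N. 2 * \<tau> * inner_L2 M (\<psi> s) (?\<phi> s))"
    by (simp add: energy_identity[OF \<psi>])
  also have "\<dots> \<le> (LINT s:{..t}|N. 2 * inner_L2 M (\<mu> s) (?\<phi> s)
      + (inner_L2 M (f s) (f s) + (2 * L + 1) * inner_L2 M (?\<phi> s) (?\<phi> s)))"
  proof (rule set_integral_mono_AE)
    show "AE s\<in>{..t} in N. 2 * \<tau> * inner_L2 M (\<psi> s) (?\<phi> s)
        \<le> 2 * inner_L2 M (\<mu> s) (?\<phi> s)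
          + (inner_L2 M (f s) (f s) + (2 * L + 1) * inner_L2 M (?\<phi> s) (?\<phi> s))"
      using dissipation AE_square_integrable_slice[OF f] AE_square_integrable_slice[OF \<phi>]
    proof eventually_elim
      case (elim s)
      from elim(1) inner_L2_double_le[OF elim(2,3)] show ?case
        by (simp add: distrib_right)
    qed
  qed (use ints in \<open>auto intro!: set_integral_add set_integrable_mult_right\<close>)
  also have "\<dots> = 2 * (LINT s:{..t}|N. inner_L2 M (\<mu> s) (?\<phi> s)) + ((LINT s:{..t}|N. inner_L2 M (f s) (f s))
      + (2 * L + 1) * (LINT s:{..t}|N. inner_L2 M (?\<phi> s) (?\<phi> s)))"
    using ints by (simp add: set_integral_add set_integrable_mult_right)
  also have "(LINT s:{..t}|N. inner_L2 M (\<mu> s) (?\<phi> s)) \<le> 0"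
    by (rule integral_potential_nonpos[OF \<psi> \<mu> c evolution])
  also have "(LINT s:{..t}|N. inner_L2 M (f s) (f s)) \<le> (\<integral>s. inner_L2 M (f s) (f s) \<partial>N)"
    by (intro set_integral_atMost_le_integral integrable_inner_L2_slices f inner_L2_self_nonneg)
  finally show ?thesis by simp
qed

end

subsection \<open>The energy estimate on a time interval\<close>

lemma finite_diffuse_lebesgue_on_Ioo: "finite_diffuse_measure (lebesgue_on {a<..<b})"
proof -
  interpret finite_measure "lebesgue_on {a<..<b}"
    by (intro finite_measure_lebesgue_on bounded_set_imp_lmeasurable) auto
  show ?thesis
  proof
    show "(\<lambda>s. s) \<in> borel_measurable (lebesgue_on {a<..<b})"
      using id_borel_measurable_lebesgue_on by (simp add: id_def)
    show "AE s in lebesgue_on {a<..<b}. s \<noteq> r" for r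
      using AE_completion[OF AE_lborel_singleton[of r]]
      by (subst AE_restrict_space_iff) auto
  qed
qed

lemma set_integral_atMost_lebesgue_on_Ioo:
  fixes g :: "real \<Rightarrow> real"
  assumes g: "integrable (lebesgue_on {a<..<b}) g" and t: "t \<in> {a..b}"
  shows "(LINT s:{..t}|lebesgue_on {a<..<b}. g s) = integral {a..t} g"
proof -
  interpret finite_diffuse_measure "lebesgue_on {a<..<b}"
    by (rule finite_diffuse_lebesgue_on_Ioo)
  let ?h = "\<lambda>s. indicator {..t} s *\<^sub>R g s"
  have "integrable (lebesgue_on {a<..<b}) ?h"
    using set_integrable_atMost[OF g] by (simp add: set_integrable_def)
  then have "(LINT s:{..t}|lebesgue_on {a<..<b}. g s) = integral {a<..<b} ?h"
    unfolding set_lebesgue_integral_def by (intro lebesgue_integral_eq_integral) auto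
  also have "\<dots> = integral {a..b} ?h"
    by (simp add: integral_open_interval_real)
  also have "\<dots> = integral {a..b} (\<lambda>s. if s \<in> {..t} then g s else 0)"
    by (intro Henstock_Kurzweil_Integration.integral_cong) simp
  also have "\<dots> = integral ({..t} \<inter> {a..b}) g"
    by (rule Henstock_Kurzweil_Integration.integral_restrict_Int)
  also have "{..t} \<inter> {a..b} = {a..t}"
    using t by auto
  finally show ?thesis .
qed

lemma Gronwall_integral:
  fixes y :: "real \<Rightarrow> real"
  assumes cont: "continuous_on {0..T} y" and b: "0 \<le> b"
    and le: "\<And>t. t \<in> {0..T} \<Longrightarrow> y t \<le> a + b * integral {0..t} y" and t: "t \<in> {0..T}"
  shows "y t \<le> a * exp (b * t)"
proof -
  define Z where "Z s = exp (- b * s) * (a + b * integral {0..s} y)" for s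
  have "Z t \<le> Z 0"
  proof (rule DERIV_nonpos_imp_decreasing_open[of 0 t])
    show "0 \<le> t" using t by simp
    show "continuous_on {0..t} Z"
      unfolding Z_def
      by (intro continuous_intros indefinite_integral_continuous_1 integrable_continuous_real
          continuous_on_subset[OF cont]) (use t in auto)
    fix s assume s: "0 < s" "s < t"
    have "((\<lambda>x. integral {0..x} y) has_real_derivative y s) (at s within {0..T})"
      using s t by (intro integral_has_real_derivative cont) auto
    then have deriv: "((\<lambda>x. integral {0..x} y) has_real_derivative y s) (at s)"
      using s t by (simp add: at_within_Icc_at)
    have "(Z has_real_derivative (exp (- b * s) * b * (y s - (a + b * integral {0..s} y)))) (at s)"
      unfolding Z_def by (rule derivative_eq_intros deriv refl)+ (simp add: algebra_simps)
    moreover have "exp (- b * s) * b * (y s - (a + b * integral {0..s} y)) \<le> 0"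
      using le[of s] s t b by (intro mult_nonneg_nonpos) auto
    ultimately show "\<exists>d. (Z has_real_derivative d) (at s) \<and> d \<le> 0" by blast
  qed
  then have "exp (- b * t) * (a + b * integral {0..t} y) \<le> a"
    by (simp add: Z_def)
  then have "exp (b * t) * (exp (- b * t) * (a + b * integral {0..t} y)) \<le> exp (b * t) * a"
    by (intro mult_left_mono) auto
  then have "a + b * integral {0..t} y \<le> exp (b * t) * a"
    by (simp add: mult.assoc[symmetric] flip: exp_add)
  with le[OF t] show ?thesis by (simp add: mult.commute)
qed

locale L2_evolution_Ioo = L2_evolution "lebesgue_on {0<..<T}" M e
  for T :: real and M :: "'a measure" and e :: "nat \<Rightarrow> 'a \<Rightarrow> real"
begin

abbreviation N :: "real measure" where "N \<equiv> lebesgue_on {0<..<T}"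

lemma continuous_on_primitive_energy:
  assumes \<psi>: "L2_path \<psi>"
  shows "continuous_on {0..T} (\<lambda>t. inner_L2 M (primitive \<psi> t) (primitive \<psi> t))"
proof -
  let ?p = "\<lambda>s. inner_L2 M (\<psi> s) (primitive \<psi> s)"
  have int: "integrable N ?p"
    by (intro integrable_inner_L2_slices L2_path_primitive \<psi>)
  have "?p integrable_on {0..T}"
    using integrable_on_lebesgue_on[OF int] by (simp add: integrable_on_open_interval_real)
  then have "continuous_on {0..T} (\<lambda>t. 2 * integral {0..t} ?p)"
    by (intro continuous_intros indefinite_integral_continuous_1)
  moreover have "2 * integral {0..t} ?p = inner_L2 M (primitive \<psi> t) (primitive \<psi> t)"
    if "t \<in> {0..T}" for t
    using energy_identity[OF \<psi>, of t] set_integral_atMost_lebesgue_on_Ioo[OF int that] by simp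
  ultimately show ?thesis by (rule continuous_on_eq)
qed

theorem energy_estimate:
  assumes \<psi>: "L2_path \<psi>" and \<mu>: "L2_path \<mu>" and f: "L2_path f" and c: "\<And>j. 0 \<le> c j"
    and evolution: "AE s in N. \<forall>j. coeff (\<psi> s) j + c j * coeff (\<mu> s) j = 0"
    and dissipation: "AE s in N. \<tau> * inner_L2 M (\<psi> s) (primitive \<psi> s)
      \<le> inner_L2 M (\<mu> s) (primitive \<psi> s) + inner_L2 M (f s) (primitive \<psi> s)
        + L * inner_L2 M (primitive \<psi> s) (primitive \<psi> s)"
    and \<tau>: "0 < \<tau>" and L: "0 \<le> L" and t: "t \<in> {0..T}"
  shows "inner_L2 M (primitive \<psi> t) (primitive \<psi> t)
    \<le> exp ((2 * L + 1) / \<tau> * T) / \<tau> * (\<integral>s. inner_L2 M (f s) (f s) \<partial>N)"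
proof -
  define y where "y s = inner_L2 M (primitive \<psi> s) (primitive \<psi> s)" for s
  define K where "K = (\<integral>s. inner_L2 M (f s) (f s) \<partial>N)"
  have "y t \<le> K / \<tau> + (2 * L + 1) / \<tau> * integral {0..t} y" if t: "t \<in> {0..T}" for t
  proof -
    have "integrable N y"
      unfolding y_def by (intro integrable_inner_L2_slices L2_path_primitive \<psi>)
    then have "\<tau> * y t \<le> K + (2 * L + 1) * integral {0..t} y"
      using energy_inequality[OF \<psi> \<mu> f c evolution dissipation, of t]
        set_integral_atMost_lebesgue_on_Ioo[OF _ t]
      by (simp add: K_def flip: y_def)
    then show ?thesis
      using \<tau> by (simp add: field_simps)
  qed
  moreover have "continuous_on {0..T} y"
    unfolding y_def by (rule continuous_on_primitive_energy[OF \<psi>])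
  moreover have rate: "0 \<le> (2 * L + 1) / \<tau>"
    using \<tau> L by simp
  ultimately have "y t \<le> K / \<tau> * exp ((2 * L + 1) / \<tau> * t)"
    using Gronwall_integral t by blast
  also have "\<dots> \<le> K / \<tau> * exp ((2 * L + 1) / \<tau> * T)"
  proof -
    have "0 \<le> K" by (simp add: K_def inner_L2_self_nonneg)
    moreover have "(2 * L + 1) / \<tau> * t \<le> (2 * L + 1) / \<tau> * T"
      using rate t by (intro mult_left_mono) auto
    ultimately show ?thesis
      using \<tau> by (intro mult_left_mono) auto
  qed
  finally show ?thesis by (simp add: y_def K_def mult.commute)
qed

end

subsection \<open>Lebesgue measure on products\<close>

lemma (in sigma_finite_measure) sigma_finite_completion: "sigma_finite_measure (completion M)"
proof -
  obtain A where A: "countable A" "A \<subseteq> sets M" "\<Union>A = space M" "\<forall>a\<in>A. emeasure M a \<noteq> \<infinity>"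
    using sigma_finite_countable by blast
  then have "\<forall>a\<in>A. emeasure (completion M) a \<noteq> \<infinity>" "A \<subseteq> sets (completion M)"
    by auto
  with A show ?thesis
    by (intro sigma_finite_measure.intro exI[of _ A]) simp
qed

lemma pair_sigma_finite_lebesgue_on:
  assumes "S \<in> sets lebesgue" "S' \<in> sets lebesgue"
  shows "pair_sigma_finite (lebesgue_on S) (lebesgue_on S')"
  using assms
  by (intro pair_sigma_finite.intro sigma_finite_measure_restrict_space lborel.sigma_finite_completion)

lemma complete_measure_lebesgue_on: "S \<in> sets lebesgue \<Longrightarrow> complete_measure (lebesgue_on S)"
  by (rule complete_measure_restrict_space[OF completion.complete_measure_axioms])

lemma borel_measurable_lebesgue_on_Times:
  fixes g :: "'a::euclidean_space \<times> 'b::euclidean_space \<Rightarrow> 'c::topological_space"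
  assumes "g \<in> borel_measurable borel"
  shows "g \<in> borel_measurable (lebesgue_on S \<Otimes>\<^sub>M lebesgue_on S')"
proof -
  have ident: "(\<lambda>x. x) \<in> borel_measurable (lebesgue_on A)" for A :: "'d::euclidean_space set"
    using id_borel_measurable_lebesgue_on by (simp add: id_def)
  have "(\<lambda>z. (fst z, snd z)) \<in> lebesgue_on S \<Otimes>\<^sub>M lebesgue_on S' \<rightarrow>\<^sub>M borel \<Otimes>\<^sub>M borel"
    by (intro measurable_Pair measurable_compose[OF measurable_fst ident]
        measurable_compose[OF measurable_snd ident])
  from measurable_compose[OF this] assms show ?thesis
    by (simp add: borel_prod)
qed

lemma nn_integral_lebesgue_on_Times:
  fixes f :: "'a::euclidean_space \<times> 'b::euclidean_space \<Rightarrow> ennreal"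
  assumes S: "S \<in> sets borel" and S': "S' \<in> sets borel" and f: "f \<in> borel_measurable borel"
  shows "(\<integral>\<^sup>+z. f z \<partial>(lebesgue_on S \<Otimes>\<^sub>M lebesgue_on S')) = (\<integral>\<^sup>+z. f z \<partial>lebesgue_on (S \<times> S'))"
proof -
  interpret pair_sigma_finite "lebesgue_on S" "lebesgue_on S'"
    using S S' by (intro pair_sigma_finite_lebesgue_on) auto
  have restrict: "(\<integral>\<^sup>+x. h x \<partial>lebesgue_on A) = (\<integral>\<^sup>+x. h x * indicator A x \<partial>lborel)"
    if "A \<in> sets borel" for A and h :: "'d::euclidean_space \<Rightarrow> ennreal"
    using that by (subst nn_integral_restrict_space) (auto simp: nn_integral_completion)
  have "S \<times> S' \<in> sets borel"
    using S S' by (simp flip: borel_prod)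
  have "(\<integral>\<^sup>+z. f z \<partial>(lebesgue_on S \<Otimes>\<^sub>M lebesgue_on S'))
      = (\<integral>\<^sup>+x. \<integral>\<^sup>+y. f (x, y) \<partial>lebesgue_on S' \<partial>lebesgue_on S)"
    by (rule M2.nn_integral_fst[OF borel_measurable_lebesgue_on_Times[OF f], symmetric])
  also have "\<dots> = (\<integral>\<^sup>+x. \<integral>\<^sup>+y. f (x, y) * indicator (S \<times> S') (x, y) \<partial>lborel \<partial>lborel)"
    unfolding restrict[OF S] restrict[OF S']
    by (intro nn_integral_cong) (auto simp: indicator_def)
  also have "\<dots> = (\<integral>\<^sup>+z. f z * indicator (S \<times> S') z \<partial>(lborel \<Otimes>\<^sub>M lborel))"
    using f \<open>S \<times> S' \<in> sets borel\<close>
    by (intro lborel.nn_integral_fst) (simp add: lborel_prod)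
  also have "\<dots> = (\<integral>\<^sup>+z. f z \<partial>lebesgue_on (S \<times> S'))"
    by (simp add: lborel_prod restrict[OF \<open>S \<times> S' \<in> sets borel\<close>])
  finally show ?thesis .
qed

lemma AE_lebesgue_on_Times:
  fixes P :: "'a::euclidean_space \<times> 'b::euclidean_space \<Rightarrow> bool"
  assumes S: "S \<in> sets borel" and S': "S' \<in> sets borel" and P: "AE z in lebesgue_on (S \<times> S'). P z"
  shows "AE z in lebesgue_on S \<Otimes>\<^sub>M lebesgue_on S'. P z"
proof -
  have Times: "S \<times> S' \<in> sets borel"
    using S S' by (simp flip: borel_prod)
  have "AE z in lborel. z \<in> S \<times> S' \<longrightarrow> P z"
    using P Times by (simp add: AE_restrict_space_iff AE_completion_iff)
  then obtain Z where Z: "Z \<in> null_sets lborel" "\<And>z. z \<notin> Z \<Longrightarrow> z \<in> S \<times> S' \<Longrightarrow> P z"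
    by (auto elim!: AE_E3)
  have [measurable]: "Z \<in> sets borel"
    using Z(1) by auto
  have "AE z in lebesgue. z \<in> S \<times> S' \<longrightarrow> z \<notin> Z"
    using AE_completion[OF AE_not_in[OF Z(1)]] by eventually_elim simp
  then have "AE z in lebesgue_on (S \<times> S'). z \<notin> Z"
    using Times by (simp add: AE_restrict_space_iff)
  then have "(\<integral>\<^sup>+z. indicator Z z \<partial>lebesgue_on (S \<times> S')) = (\<integral>\<^sup>+z. 0 \<partial>lebesgue_on (S \<times> S'))"
    by (intro nn_integral_cong_AE) (auto elim: eventually_mono)
  then have "(\<integral>\<^sup>+z. indicator Z z \<partial>(lebesgue_on S \<Otimes>\<^sub>M lebesgue_on S')) = 0"
    by (simp add: nn_integral_lebesgue_on_Times[OF S S'])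
  then have "AE z in lebesgue_on S \<Otimes>\<^sub>M lebesgue_on S'. indicator Z z = (0 :: ennreal)"
    by (subst (asm) nn_integral_0_iff_AE) (simp_all add: borel_measurable_lebesgue_on_Times)
  then show ?thesis
    using AE_space
  proof eventually_elim
    case (elim z)
    then have "z \<notin> Z" "z \<in> S \<times> S'"
      by (auto simp: space_pair_measure split: split_indicator_asm)
    then show ?case by (rule Z(2))
  qed
qed

lemma lebesgue_on_ex_borel_measurable:
  fixes f :: "'a::euclidean_space \<Rightarrow> real"
  assumes S: "S \<in> sets lebesgue" and f: "f \<in> borel_measurable (lebesgue_on S)"
  shows "\<exists>g\<in>borel_measurable borel. AE x in lebesgue_on S. f x = g x"
proof -
  have "(\<lambda>x. indicator S x *\<^sub>R f x) \<in> borel_measurable lebesgue"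
    using S f by (subst borel_measurable_restrict_space_iff[symmetric]) auto
  then obtain g where g: "g \<in> borel_measurable lborel" "AE x in lborel. indicator S x *\<^sub>R f x = g x"
    using completion_ex_borel_measurable_real by blast
  have "AE x in lebesgue. x \<in> S \<longrightarrow> f x = g x"
    using AE_completion[OF g(2)] by eventually_elim auto
  then have "AE x in lebesgue_on S. f x = g x"
    using S by (simp add: AE_restrict_space_iff)
  with g(1) show ?thesis by auto
qed

text \<open>A function measurable for \<^term>\<open>lebesgue_on (S \<times> S')\<close> need not be measurable for the product of
  the completed measures, but it has a version that is.\<close>
lemma square_integrable_lebesgue_on_Times_version:
  fixes f :: "'a::euclidean_space \<times> 'b::euclidean_space \<Rightarrow> real"
  assumes S: "S \<in> sets borel" and S': "S' \<in> sets borel" and f: "square_integrable (lebesgue_on (S \<times> S')) f"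
  obtains g where "square_integrable (lebesgue_on S \<Otimes>\<^sub>M lebesgue_on S') g"
    and "AE z in lebesgue_on S \<Otimes>\<^sub>M lebesgue_on S'. f z = g z"
    and "inner_L2 (lebesgue_on S \<Otimes>\<^sub>M lebesgue_on S') g g = inner_L2 (lebesgue_on (S \<times> S')) f f"
proof -
  have Times: "S \<times> S' \<in> sets borel"
    using S S' by (simp flip: borel_prod)
  interpret complete_measure "lebesgue_on (S \<times> S')"
    using Times by (intro complete_measure_lebesgue_on) simp
  obtain g where g: "g \<in> borel_measurable borel" and eq: "AE z in lebesgue_on (S \<times> S'). f z = g z"
    using lebesgue_on_ex_borel_measurable[OF _ square_integrable_measurable[OF f]] Times by auto
  have inner: "inner_L2 (lebesgue_on (S \<times> S')) f f = inner_L2 (lebesgue_on (S \<times> S')) g g"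
    by (rule inner_L2_cong_AE[OF eq eq])
  have norm_g: "(\<integral>\<^sup>+z. ennreal ((g z)\<^sup>2) \<partial>(lebesgue_on S \<Otimes>\<^sub>M lebesgue_on S'))
      = ennreal (inner_L2 (lebesgue_on (S \<times> S')) f f)"
    using g nn_integral_square[OF square_integrable_cong_AE[OF f eq]]
    by (simp add: nn_integral_lebesgue_on_Times[OF S S'] inner)
  have g': "g \<in> borel_measurable (lebesgue_on S \<Otimes>\<^sub>M lebesgue_on S')"
    by (rule borel_measurable_lebesgue_on_Times[OF g])
  then have "integrable (lebesgue_on S \<Otimes>\<^sub>M lebesgue_on S') (\<lambda>z. (g z)\<^sup>2)"
    using norm_g by (intro integrableI_nonneg borel_measurable_power) simp_all
  with g' have square: "square_integrable (lebesgue_on S \<Otimes>\<^sub>M lebesgue_on S') g"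
    by (simp add: square_integrable_def)
  show ?thesis
  proof (rule that[OF square AE_lebesgue_on_Times[OF S S' eq]])
    show "inner_L2 (lebesgue_on S \<Otimes>\<^sub>M lebesgue_on S') g g = inner_L2 (lebesgue_on (S \<times> S')) f f"
      using norm_g by (simp add: nn_integral_square[OF square] inner_L2_self_nonneg)
  qed
qed

subsection \<open>Spectral powers and projections\<close>

lemma L2_eq_square_integrable: "L2 \<Omega> v \<longleftrightarrow> square_integrable (lebesgue_on \<Omega>) v"
  by (simp add: L2_def square_integrable_def)

lemma ip_eq_inner_L2: "ip \<Omega> v w = inner_L2 (lebesgue_on \<Omega>) v w"
  by (simp add: ip_def inner_L2_def)

lemma nrm_eq_norm_L2: "nrm \<Omega> v = norm_L2 (lebesgue_on \<Omega>) v"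
  by (simp add: nrm_def norm_L2_def ip_eq_inner_L2)

lemmas L2_notions = L2_eq_square_integrable ip_eq_inner_L2 nrm_eq_norm_L2

lemma orthonormal_basis_of_ONB: "ONB \<Omega> e \<Longrightarrow> orthonormal_basis (lebesgue_on \<Omega>) e"
  by unfold_locales (simp_all add: ONB_def L2_notions)

lemma spectral_data_ONB: "spectral_data \<Omega> lam e \<Longrightarrow> ONB \<Omega> e"
  by (simp add: spectral_data_def)

lemma spectral_data_eventually_ge_1:
  "spectral_data \<Omega> lam e \<Longrightarrow> \<forall>\<^sub>F j in sequentially. 1 \<le> lam j"
  by (simp add: spectral_data_def filterlim_at_top)

lemma basis_in_spec_dom:
  assumes "ONB \<Omega> e"
  shows "e k \<in> spec_dom \<Omega> lam e s"
proof -
  have "summable (\<lambda>j. (lam j powr s * ip \<Omega> (e k) (e j))\<^sup>2)"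
    using assms by (intro summable_finite[of "{k}"]) (auto simp: ONB_def)
  then show ?thesis
    using assms by (simp add: spec_dom_def ONB_def)
qed

lemma spec_dom_antimono:
  assumes "spectral_data \<Omega> lam e" "s \<le> s'"
  shows "spec_dom \<Omega> lam e s' \<subseteq> spec_dom \<Omega> lam e s"
proof
  fix v assume v: "v \<in> spec_dom \<Omega> lam e s'"
  have "\<forall>\<^sub>F j in sequentially. norm ((lam j powr s * ip \<Omega> v (e j))\<^sup>2) \<le> (lam j powr s' * ip \<Omega> v (e j))\<^sup>2"
    using spectral_data_eventually_ge_1[OF assms(1)]
  proof eventually_elim
    case (elim j)
    then have "lam j powr s \<le> lam j powr s'" by (intro powr_mono assms)
    then show ?case by (auto simp: power_mult_distrib intro!: mult_right_mono power_mono)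
  qed
  then have "summable (\<lambda>j. (lam j powr s * ip \<Omega> v (e j))\<^sup>2)"
    by (rule summable_comparison_test_ev) (use v in \<open>simp add: spec_dom_def\<close>)
  with v show "v \<in> spec_dom \<Omega> lam e s" by (simp add: spec_dom_def)
qed

text \<open>By the Riesz-Fischer theorem the choice in \<^const>\<open>spec_pow\<close> is not from an empty set.\<close>
lemma
  assumes e: "ONB \<Omega> e" and v: "v \<in> spec_dom \<Omega> lam e s"
  shows L2_spec_pow: "L2 \<Omega> (spec_pow \<Omega> lam e s v)"
    and ip_spec_pow: "ip \<Omega> (spec_pow \<Omega> lam e s v) (e k) = lam k powr s * ip \<Omega> v (e k)"
proof -
  interpret orthonormal_basis "lebesgue_on \<Omega>" e
    by (rule orthonormal_basis_of_ONB[OF e])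
  let ?a = "\<lambda>j. lam j powr s * ip \<Omega> v (e j)"
  let ?w = "spec_pow \<Omega> lam e s v"
  let ?S = "\<lambda>n x. \<Sum>j<n. ?a j * e j x"
  have "\<exists>w. L2 \<Omega> w \<and> (\<lambda>n. nrm \<Omega> (\<lambda>x. w x - ?S n x)) \<longlonglongrightarrow> 0"
    unfolding L2_eq_square_integrable nrm_eq_norm_L2
    using v by (intro Riesz_Fischer) (simp add: spec_dom_def)
  from someI_ex[OF this] have w: "L2 \<Omega> ?w" "(\<lambda>n. nrm \<Omega> (\<lambda>x. ?w x - ?S n x)) \<longlonglongrightarrow> 0"
    by (simp_all add: spec_pow_def)
  show "L2 \<Omega> ?w" by (rule w(1))
  have "(\<lambda>n. coeff (?S n) k) \<longlonglongrightarrow> coeff ?w k"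
    using w square_integrable_lincomb square_integrable_basis
    unfolding L2_eq_square_integrable nrm_eq_norm_L2 by (intro inner_L2_tendsto)
  moreover have "\<forall>\<^sub>F n in sequentially. coeff (?S n) k = ?a k"
    using eventually_gt_at_top[of k] by eventually_elim (simp add: coeff_lincomb)
  then have "(\<lambda>n. coeff (?S n) k) \<longlonglongrightarrow> ?a k"
    by (rule tendsto_eventually)
  ultimately show "ip \<Omega> ?w (e k) = ?a k"
    unfolding ip_eq_inner_L2 by (rule LIMSEQ_unique)
qed

lemma ip_spec_pow_basis:
  assumes e: "ONB \<Omega> e" and v: "v \<in> spec_dom \<Omega> lam e s"
  shows "ip \<Omega> (spec_pow \<Omega> lam e s v) (spec_pow \<Omega> lam e s (e k)) = (lam k powr s)\<^sup>2 * ip \<Omega> v (e k)"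
proof -
  interpret orthonormal_basis "lebesgue_on \<Omega>" e
    by (rule orthonormal_basis_of_ONB[OF e])
  let ?V = "spec_pow \<Omega> lam e s v" and ?E = "spec_pow \<Omega> lam e s (e k)"
  note ek = basis_in_spec_dom[OF e, of k lam s]
  have "(\<lambda>j. ip \<Omega> ?V (e j) * ip \<Omega> ?E (e j)) sums ip \<Omega> ?V ?E"
    using Parseval L2_spec_pow[OF e v] L2_spec_pow[OF e ek] by (simp add: L2_notions)
  moreover have "(\<lambda>j. ip \<Omega> ?V (e j) * ip \<Omega> ?E (e j))
      = (\<lambda>j. if j = k then (lam j powr s)\<^sup>2 * ip \<Omega> v (e j) else 0)"
    using e by (auto simp: ONB_def ip_spec_pow[OF e v] ip_spec_pow[OF e ek] power2_eq_square)
  ultimately show ?thesis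
    using sums_single[of k "\<lambda>j. (lam j powr s)\<^sup>2 * ip \<Omega> v (e j)"] by (simp add: sums_unique2)
qed

lemma L2_ker_proj:
  assumes "ONB \<Omega> e"
  shows "L2 \<Omega> (ker_proj \<Omega> lam e v)"
proof -
  interpret orthonormal_basis "lebesgue_on \<Omega>" e
    by (rule orthonormal_basis_of_ONB[OF assms])
  show ?thesis
    unfolding ker_proj_def L2_eq_square_integrable by (rule square_integrable_lincomb)
qed

lemma ker_proj_diff:
  assumes "ONB \<Omega> e" "L2 \<Omega> v" "L2 \<Omega> w"
  shows "ker_proj \<Omega> lam e (\<lambda>x. v x - w x) x = ker_proj \<Omega> lam e v x - ker_proj \<Omega> lam e w x"
  using assms
  by (simp add: ker_proj_def ONB_def L2_notions inner_L2_diff_left left_diff_distrib sum_subtractf)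

lemma ker_proj_complement_nonneg:
  assumes sd: "spectral_data \<Omega> lam e" and v: "L2 \<Omega> v"
  shows "0 \<le> ip \<Omega> (\<lambda>x. v x - ker_proj \<Omega> lam e v x) v"
proof -
  interpret orthonormal_basis "lebesgue_on \<Omega>" e
    by (rule orthonormal_basis_of_ONB[OF spectral_data_ONB[OF sd]])
  let ?K = "{j. lam j = 0}"
  obtain n where n: "\<And>j. n \<le> j \<Longrightarrow> 1 \<le> lam j"
    using spectral_data_eventually_ge_1[OF sd] by (auto simp: eventually_sequentially)
  have "j < n" if "lam j = 0" for j
    using n[of j] that by (cases "n \<le> j") auto
  then have "finite ?K"
    by (intro finite_subset[of ?K "{..<n}"]) auto
  moreover have v': "square_integrable (lebesgue_on \<Omega>) v"
    using v by (simp add: L2_eq_square_integrable)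
  ultimately have "(\<Sum>j\<in>?K. (coeff v j)\<^sup>2) \<le> inner_L2 (lebesgue_on \<Omega>) v v"
    by (rule Bessel_inequality)
  moreover have "inner_L2 (lebesgue_on \<Omega>) (ker_proj \<Omega> lam e v) v = (\<Sum>j\<in>?K. (coeff v j)\<^sup>2)"
    by (simp add: ker_proj_def inner_lincomb_left[OF v'] ip_eq_inner_L2 power2_eq_square)
  ultimately show ?thesis
    using L2_ker_proj[OF spectral_data_ONB[OF sd], of lam v] v'
    by (simp add: L2_notions inner_L2_diff_left)
qed

lemma ker_proj_complement_monotone:
  assumes sd: "spectral_data \<Omega> lam e" and v: "L2 \<Omega> v" and w: "L2 \<Omega> w"
  shows "ip \<Omega> (\<lambda>x. w x - ker_proj \<Omega> lam e w x) (\<lambda>x. v x - w x)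
    \<le> ip \<Omega> (\<lambda>x. v x - ker_proj \<Omega> lam e v x) (\<lambda>x. v x - w x)"
proof -
  note e = spectral_data_ONB[OF sd]
  let ?P = "ker_proj \<Omega> lam e"
  have d: "L2 \<Omega> (\<lambda>x. v x - w x)"
    using v w by (simp add: L2_eq_square_integrable square_integrable_diff)
  have "0 \<le> ip \<Omega> (\<lambda>x. (v x - ?P v x) - (w x - ?P w x)) (\<lambda>x. v x - w x)"
    using ker_proj_complement_nonneg[OF sd d] by (simp add: ker_proj_diff[OF e v w] algebra_simps)
  then show ?thesis
    using v w d L2_ker_proj[OF e] by (simp add: L2_notions inner_L2_diff_left square_integrable_diff)
qed

subsection \<open>Solutions of the limiting problem\<close>

lemma L2T_eq_square_integrable:
  "L2T \<Omega> T f \<longleftrightarrow> square_integrable (lebesgue_on ({0<..<T} \<times> \<Omega>)) (case_prod f)"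
  by (simp add: L2T_def square_integrable_def case_prod_beta')

lemma L2T_norm_square:
  "(L2T_norm \<Omega> T f)\<^sup>2 = inner_L2 (lebesgue_on ({0<..<T} \<times> \<Omega>)) (case_prod f) (case_prod f)"
  by (simp add: L2T_norm_def inner_L2_def case_prod_beta' power2_eq_square)

lemma L2T_diff:
  assumes "L2T \<Omega> T f" "L2T \<Omega> T g"
  shows "L2T \<Omega> T (\<lambda>t x. f t x - g t x)"
  using assms square_integrable_diff[of _ "case_prod f" "case_prod g"]
  by (simp add: L2T_eq_square_integrable case_prod_beta')

lemma has_time_deriv_diff:
  assumes "has_time_deriv \<Omega> T \<phi> \<psi>" "has_time_deriv \<Omega> T \<phi>' \<psi>'"
  shows "has_time_deriv \<Omega> T (\<lambda>t x. \<phi> t x - \<phi>' t x) (\<lambda>t x. \<psi> t x - \<psi>' t x)"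
  unfolding has_time_deriv_def
proof (intro conjI ballI)
  have int: "AE x in lebesgue_on \<Omega>. set_integrable lborel {0..T} (\<lambda>s. \<psi> s x)"
    "AE x in lebesgue_on \<Omega>. set_integrable lborel {0..T} (\<lambda>s. \<psi>' s x)"
    using assms by (simp_all add: has_time_deriv_def)
  then show "AE x in lebesgue_on \<Omega>. set_integrable lborel {0..T} (\<lambda>s. \<psi> s x - \<psi>' s x)"
    by eventually_elim (rule set_integral_diff)
  fix t assume t: "t \<in> {0..T}"
  have "AE x in lebesgue_on \<Omega>. \<phi> t x = \<phi> 0 x + (LINT s:{0..t}|lborel. \<psi> s x)"
    "AE x in lebesgue_on \<Omega>. \<phi>' t x = \<phi>' 0 x + (LINT s:{0..t}|lborel. \<psi>' s x)"
    using assms t by (simp_all add: has_time_deriv_def)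
  with int show "AE x in lebesgue_on \<Omega>. \<phi> t x - \<phi>' t x
      = \<phi> 0 x - \<phi>' 0 x + (LINT s:{0..t}|lborel. \<psi> s x - \<psi>' s x)"
  proof eventually_elim
    case (elim x)
    then have "set_integrable lborel {0..t} (\<lambda>s. \<psi> s x)" "set_integrable lborel {0..t} (\<lambda>s. \<psi>' s x)"
      using t by (auto intro: set_integrable_subset)
    with elim show ?case by simp
  qed
next
  show "L2 \<Omega> (\<lambda>x. \<phi> 0 x - \<phi>' 0 x)"
    using assms by (simp add: has_time_deriv_def L2_notions square_integrable_diff)
qed (use assms in \<open>auto simp: has_time_deriv_def intro: L2T_diff\<close>)

lemma set_integral_lborel_Icc_eq_lebesgue_on_Ioo:
  fixes h :: "real \<Rightarrow> real"
  assumes h: "set_integrable lborel {0..T} h" and t: "t \<in> {0..T}"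
  shows "(LINT s:{0..t}|lborel. h s) = (LINT s:{..t}|lebesgue_on {0<..<T}. h s)"
proof -
  have "set_integrable lborel {0<..<T} h"
    by (rule set_integrable_subset[OF h]) auto
  then have "integrable lebesgue (\<lambda>s. indicator {0<..<T} s *\<^sub>R h s)"
    unfolding set_integrable_def by (subst integrable_completion) auto
  then have "integrable (lebesgue_on {0<..<T}) h"
    by (simp add: integrable_restrict_space)
  moreover have "set_integrable lborel {0..t} h"
    by (rule set_integrable_subset[OF h]) (use t in auto)
  ultimately show ?thesis
    using t by (simp add: set_borel_integral_eq_integral(2) set_integral_atMost_lebesgue_on_Ioo)
qed

locale limiting_problem =
  fixes \<Omega> lam e lam' e' r \<sigma>0 \<tau> \<beta> \<pi>h \<pi> L and T :: real
  assumes setting: "setting \<Omega> lam e lam' e' r \<sigma>0 \<tau> \<beta> \<pi>h \<pi> L"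
begin

lemma open_domain: "open \<Omega>"
  and bounded_domain: "bounded \<Omega>"
  and spectral_data_A: "spectral_data \<Omega> lam e"
  and spectral_data_B: "spectral_data \<Omega> lam' e'"
  and exponent_pos: "0 < r"
  and relaxation_pos: "0 < \<tau>"
  and beta_zero: "\<beta> 0 = 0"
  and Lipschitz_const_nonneg: "0 \<le> L"
  and pi_Lipschitz_bound: "\<bar>\<pi> a - \<pi> b\<bar> \<le> L * \<bar>a - b\<bar>"
  using setting by (simp_all add: setting_def)

lemma pi_Lipschitz: "L-lipschitz_on UNIV \<pi>"
  using pi_Lipschitz_bound Lipschitz_const_nonneg by (simp add: lipschitz_on_def dist_real_def)

end

sublocale limiting_problem \<subseteq> L2_evolution_Ioo T "lebesgue_on \<Omega>" e
proof -
  interpret orthonormal_basis "lebesgue_on \<Omega>" e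
    by (intro orthonormal_basis_of_ONB spectral_data_ONB[OF spectral_data_A])
  interpret finite_diffuse_measure "lebesgue_on {0<..<T}"
    by (rule finite_diffuse_lebesgue_on_Ioo)
  interpret pair_sigma_finite "lebesgue_on {0<..<T}" "lebesgue_on \<Omega>"
    using open_domain by (intro pair_sigma_finite_lebesgue_on) auto
  show "L2_evolution_Ioo T (lebesgue_on \<Omega>) e"
    by unfold_locales
qed

sublocale limiting_problem \<subseteq> domain: complete_measure "lebesgue_on \<Omega>"
  using open_domain by (intro complete_measure_lebesgue_on) simp

sublocale limiting_problem \<subseteq> domain: finite_measure "lebesgue_on \<Omega>"
  using open_domain bounded_domain by (intro finite_measure_lebesgue_on lmeasurable_open)

sublocale limiting_problem \<subseteq> time: complete_measure N
  by (intro complete_measure_lebesgue_on) simp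

context limiting_problem
begin

abbreviation M :: "pt measure" where "M \<equiv> lebesgue_on \<Omega>"

lemma L2T_ex_path:
  assumes "L2T \<Omega> T f"
  obtains g where "L2_path g" and "AE z in N \<Otimes>\<^sub>M M. case_prod f z = case_prod g z"
    and "(\<integral>t. inner_L2 M (g t) (g t) \<partial>N) = (L2T_norm \<Omega> T f)\<^sup>2"
proof -
  have f: "square_integrable (lebesgue_on ({0<..<T} \<times> \<Omega>)) (case_prod f)"
    using assms by (simp add: L2T_eq_square_integrable)
  have borel: "{0<..<T} \<in> sets borel" "\<Omega> \<in> sets borel"
    using open_domain by auto
  obtain h where h: "square_integrable (N \<Otimes>\<^sub>M M) h" "AE z in N \<Otimes>\<^sub>M M. case_prod f z = h z"
    "inner_L2 (N \<Otimes>\<^sub>M M) h h = (L2T_norm \<Omega> T f)\<^sup>2"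
    unfolding L2T_norm_square by (rule square_integrable_lebesgue_on_Times_version[OF borel f])
  show ?thesis
    by (rule that[of "curry h"]) (use h integral_inner_L2_slices[of "curry h" "curry h"] in simp_all)
qed

lemma L2T_AE_square_integrable:
  assumes "L2T \<Omega> T f"
  shows "AE t in N. square_integrable M (f t)"
proof -
  obtain g where g: "L2_path g" "AE z in N \<Otimes>\<^sub>M M. case_prod f z = case_prod g z"
    by (rule L2T_ex_path[OF assms]) blast
  from AE_square_integrable_slice[OF g(1)] AE_pair[OF g(2)] show ?thesis
  proof eventually_elim
    case (elim t)
    then have "AE x in M. g t x = f t x"
      by (auto elim: eventually_mono)
    from domain.square_integrable_cong_AE[OF elim(1) this] show ?case .
  qed
qed

lemma has_time_deriv_primitive:
  assumes deriv: "has_time_deriv \<Omega> T \<phi> \<psi>" and initial: "AE x in M. \<phi> 0 x = 0"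
    and version: "AE z in N \<Otimes>\<^sub>M M. case_prod \<psi> z = case_prod \<Psi> z" and t: "t \<in> {0..T}"
  shows "AE x in M. \<phi> t x = primitive \<Psi> t x"
proof -
  have "AE x in M. set_integrable lborel {0..T} (\<lambda>s. \<psi> s x)"
    and "AE x in M. \<phi> t x = \<phi> 0 x + (LINT s:{0..t}|lborel. \<psi> s x)"
    using deriv t by (simp_all add: has_time_deriv_def)
  with initial AE_pair_snd[OF version] show ?thesis
  proof eventually_elim
    case (elim x)
    have "\<phi> t x = (LINT s:{..t}|N. \<psi> s x)"
      using elim(1,3,4) set_integral_lborel_Icc_eq_lebesgue_on_Ioo[OF _ t] by simp
    also have "\<dots> = primitive \<Psi> t x"
      unfolding primitive_def set_lebesgue_integral_def
    proof (rule time.integral_cong_AE_complete)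
      show "AE s in N. indicator {..t} s *\<^sub>R \<psi> s x = indicator {..t} s *\<^sub>R \<Psi> s x"
        using elim(2) by eventually_elim simp
    qed
    finally show ?case .
  qed
qed

lemma evolution_equation_coeff:
  assumes "limiting_solution \<Omega> lam e lam' e' r \<tau> T \<beta> \<pi> \<phi>0 f \<phi> \<psi> \<mu>"
  shows "AE t in N. \<forall>j. coeff (\<psi> t) j + (lam j powr r)\<^sup>2 * coeff (\<mu> t) j = 0"
proof -
  note e = spectral_data_ONB[OF spectral_data_A]
  have "AE t in N. \<mu> t \<in> spec_dom \<Omega> lam e (2 * r)"
    and "AE t in N. \<forall>v\<in>spec_dom \<Omega> lam e r.
        ip \<Omega> (\<psi> t) v + ip \<Omega> (spec_pow \<Omega> lam e r (\<mu> t)) (spec_pow \<Omega> lam e r v) = 0"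
    using assms by (simp_all add: limiting_solution_def L2T_dom_def)
  then show ?thesis
  proof eventually_elim
    case (elim t)
    have "\<mu> t \<in> spec_dom \<Omega> lam e r"
      using elim(1) spec_dom_antimono[OF spectral_data_A, of r "2 * r"] exponent_pos by auto
    then have "ip \<Omega> (spec_pow \<Omega> lam e r (\<mu> t)) (spec_pow \<Omega> lam e r (e j))
        = (lam j powr r)\<^sup>2 * ip \<Omega> (\<mu> t) (e j)" for j
      by (rule ip_spec_pow_basis[OF e])
    moreover have "ip \<Omega> (\<psi> t) (e j) + ip \<Omega> (spec_pow \<Omega> lam e r (\<mu> t)) (spec_pow \<Omega> lam e r (e j)) = 0" for j
      using elim(2) basis_in_spec_dom[OF e] by blast
    ultimately show ?case by (simp flip: ip_eq_inner_L2)
  qed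
qed

definition variational_inequality :: "fn \<Rightarrow> fn \<Rightarrow> fn \<Rightarrow> fn \<Rightarrow> bool" where
  "variational_inequality \<phi> \<psi> \<mu> f \<longleftrightarrow> (\<forall>v. L2 \<Omega> v \<longrightarrow>
     ereal (\<tau> * ip \<Omega> \<psi> (\<lambda>x. \<phi> x - v x)
            + ip \<Omega> (\<lambda>x. \<phi> x - ker_proj \<Omega> lam' e' \<phi> x) (\<lambda>x. \<phi> x - v x))
     + enn2ereal (int_beta \<Omega> \<beta> \<phi>)
     + ereal (ip \<Omega> (\<lambda>x. \<pi> (\<phi> x) - f x) (\<lambda>x. \<phi> x - v x))
     \<le> ereal (ip \<Omega> \<mu> (\<lambda>x. \<phi> x - v x)) + enn2ereal (int_beta \<Omega> \<beta> v))"

lemma variational_inequality_int_beta_finite: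
  assumes "variational_inequality \<phi> \<psi> \<mu> f"
  obtains b where "enn2ereal (int_beta \<Omega> \<beta> \<phi>) = ereal b"
proof -
  have zero: "L2 \<Omega> (\<lambda>x. 0)" "enn2ereal (int_beta \<Omega> \<beta> (\<lambda>x. 0)) = 0"
    by (simp_all add: L2_eq_square_integrable square_integrable_zero int_beta_def beta_zero
        zero_ennreal.rep_eq)
  from assms[unfolded variational_inequality_def, rule_format, OF zero(1), unfolded zero(2)]
  show ?thesis
    using enn2ereal_nonneg[of "int_beta \<Omega> \<beta> \<phi>"] that
    by (cases "enn2ereal (int_beta \<Omega> \<beta> \<phi>)") auto
qed

lemma variational_inequality_diff:
  assumes sq: "square_integrable M \<phi>" "square_integrable M \<phi>'"
      "square_integrable M \<psi>" "square_integrable M \<psi>'"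
      "square_integrable M \<mu>" "square_integrable M \<mu>'"
      "square_integrable M f" "square_integrable M f'"
    and V: "variational_inequality \<phi> \<psi> \<mu> f" and V': "variational_inequality \<phi>' \<psi>' \<mu>' f'"
  defines "d \<equiv> \<lambda>x. \<phi> x - \<phi>' x"
  shows "\<tau> * inner_L2 M (\<lambda>x. \<psi> x - \<psi>' x) d
    \<le> inner_L2 M (\<lambda>x. \<mu> x - \<mu>' x) d + inner_L2 M (\<lambda>x. f x - f' x) d + L * inner_L2 M d d"
proof -
  let ?P = "ker_proj \<Omega> lam' e'"
  have \<pi>: "square_integrable M (\<lambda>x. \<pi> (\<phi> x))" "square_integrable M (\<lambda>x. \<pi> (\<phi>' x))"
    by (rule domain.square_integrable_Lipschitz_comp[OF _ pi_Lipschitz], rule sq)+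
  have d: "square_integrable M d"
    unfolding d_def by (rule square_integrable_diff[OF sq(1,2)])
  have L2: "L2 \<Omega> \<phi>" "L2 \<Omega> \<phi>'"
    using sq by (simp_all add: L2_eq_square_integrable)
  obtain b where b: "enn2ereal (int_beta \<Omega> \<beta> \<phi>) = ereal b"
    by (rule variational_inequality_int_beta_finite[OF V])
  obtain b' where b': "enn2ereal (int_beta \<Omega> \<beta> \<phi>') = ereal b'"
    by (rule variational_inequality_int_beta_finite[OF V'])
  have tested: "\<tau> * inner_L2 M \<psi> d + inner_L2 M (\<lambda>x. \<phi> x - ?P \<phi> x) d + b + inner_L2 M (\<lambda>x. \<pi> (\<phi> x) - f x) d
      \<le> inner_L2 M \<mu> d + b'"
    using V[unfolded variational_inequality_def, rule_format, OF L2(2)]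
    unfolding b b' d_def by (simp add: ip_eq_inner_L2)
  have neg: "inner_L2 M g (\<lambda>x. \<phi>' x - \<phi> x) = - inner_L2 M g d" for g
    using inner_L2_scale_right[of M g "-1" d] by (simp add: d_def)
  have tested': "- \<tau> * inner_L2 M \<psi>' d - inner_L2 M (\<lambda>x. \<phi>' x - ?P \<phi>' x) d + b'
      - inner_L2 M (\<lambda>x. \<pi> (\<phi>' x) - f' x) d
      \<le> - inner_L2 M \<mu>' d + b"
    using V'[unfolded variational_inequality_def, rule_format, OF L2(1)]
    unfolding b b' by (simp add: ip_eq_inner_L2 neg)
  have monotone: "inner_L2 M (\<lambda>x. \<phi>' x - ?P \<phi>' x) d \<le> inner_L2 M (\<lambda>x. \<phi> x - ?P \<phi> x) d"
    using ker_proj_complement_monotone[OF spectral_data_B L2] by (simp add: ip_eq_inner_L2 d_def)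
  have "- (L * inner_L2 M d d) \<le> inner_L2 M (\<lambda>x. \<pi> (\<phi> x)) d - inner_L2 M (\<lambda>x. \<pi> (\<phi>' x)) d"
    using domain.inner_L2_Lipschitz_diff_ge[OF sq(1,2) pi_Lipschitz]
    by (simp add: inner_L2_diff_left \<pi> d flip: d_def)
  with tested tested' monotone show ?thesis
    by (simp add: inner_L2_diff_left sq \<pi> d right_diff_distrib)
qed

lemma limiting_solution_AE_variational_inequality:
  assumes "limiting_solution \<Omega> lam e lam' e' r \<tau> T \<beta> \<pi> \<phi>0 f \<phi> \<psi> \<mu>"
  shows "AE t in N. variational_inequality (\<phi> t) (\<psi> t) (\<mu> t) (f t)"
  using assms by (simp add: limiting_solution_def variational_inequality_def)

lemma limiting_solution_L2T:
  assumes "limiting_solution \<Omega> lam e lam' e' r \<tau> T \<beta> \<pi> \<phi>0 f \<phi> \<psi> \<mu>"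
  shows "L2T \<Omega> T \<phi>" "L2T \<Omega> T \<psi>" "L2T \<Omega> T \<mu>"
  using assms by (simp_all add: limiting_solution_def has_time_deriv_def L2T_dom_def)

end

locale limiting_solution_pair = limiting_problem +
  fixes \<phi>0 f1 f2 \<phi>1 \<phi>2 \<psi>1 \<psi>2 \<mu>1 \<mu>2
  assumes forcing1: "L2T \<Omega> T f1" and forcing2: "L2T \<Omega> T f2"
    and solution1: "limiting_solution \<Omega> lam e lam' e' r \<tau> T \<beta> \<pi> \<phi>0 f1 \<phi>1 \<psi>1 \<mu>1"
    and solution2: "limiting_solution \<Omega> lam e lam' e' r \<tau> T \<beta> \<pi> \<phi>0 f2 \<phi>2 \<psi>2 \<mu>2"
begin

abbreviation \<phi>d :: "real \<Rightarrow> fn" where "\<phi>d t x \<equiv> \<phi>1 t x - \<phi>2 t x"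
abbreviation \<psi>d :: "real \<Rightarrow> fn" where "\<psi>d t x \<equiv> \<psi>1 t x - \<psi>2 t x"
abbreviation \<mu>d :: "real \<Rightarrow> fn" where "\<mu>d t x \<equiv> \<mu>1 t x - \<mu>2 t x"
abbreviation fd :: "real \<Rightarrow> fn" where "fd t x \<equiv> f1 t x - f2 t x"

lemmas AE_square_integrable1 =
  limiting_solution_L2T[OF solution1, THEN L2T_AE_square_integrable] L2T_AE_square_integrable[OF forcing1]
lemmas AE_square_integrable2 =
  limiting_solution_L2T[OF solution2, THEN L2T_AE_square_integrable] L2T_AE_square_integrable[OF forcing2]

lemma difference_evolution:
  "AE t in N. \<forall>j. coeff (\<psi>d t) j + (lam j powr r)\<^sup>2 * coeff (\<mu>d t) j = 0"
  using evolution_equation_coeff[OF solution1] evolution_equation_coeff[OF solution2]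
    AE_square_integrable1(2,3) AE_square_integrable2(2,3)
proof eventually_elim
  case (elim t)
  show ?case
  proof
    fix j
    have split: "coeff (\<psi>d t) j = coeff (\<psi>1 t) j - coeff (\<psi>2 t) j"
      "coeff (\<mu>d t) j = coeff (\<mu>1 t) j - coeff (\<mu>2 t) j"
      using elim(3-6) by (simp_all add: inner_L2_diff_left square_integrable_basis)
    show "coeff (\<psi>d t) j + (lam j powr r)\<^sup>2 * coeff (\<mu>d t) j = 0"
      using elim(1,2)[rule_format, of j] unfolding split right_diff_distrib by linarith
  qed
qed

lemma difference_dissipation:
  "AE t in N. \<tau> * inner_L2 M (\<psi>d t) (\<phi>d t)
    \<le> inner_L2 M (\<mu>d t) (\<phi>d t) + inner_L2 M (fd t) (\<phi>d t) + L * inner_L2 M (\<phi>d t) (\<phi>d t)"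
  using limiting_solution_AE_variational_inequality[OF solution1]
    limiting_solution_AE_variational_inequality[OF solution2]
    AE_square_integrable1 AE_square_integrable2
  by eventually_elim (rule variational_inequality_diff)

lemma difference_primitive:
  assumes version: "AE z in N \<Otimes>\<^sub>M M. case_prod \<psi>d z = case_prod \<Psi> z" and t: "t \<in> {0..T}"
  shows "AE x in M. \<phi>d t x = primitive \<Psi> t x"
proof (rule has_time_deriv_primitive[OF _ _ version t])
  show "has_time_deriv \<Omega> T \<phi>d \<psi>d"
    using solution1 solution2 by (simp add: limiting_solution_def has_time_deriv_diff)
  have "AE x in M. \<phi>1 0 x = \<phi>0 x" "AE x in M. \<phi>2 0 x = \<phi>0 x"
    using solution1 solution2 by (simp_all add: limiting_solution_def)
  then show "AE x in M. \<phi>d 0 x = 0"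
    by eventually_elim simp
qed

lemma difference_paths:
  obtains \<Psi> m F where "L2_path \<Psi>" "L2_path m" "L2_path F"
    and "(\<integral>t. inner_L2 M (F t) (F t) \<partial>N) = (L2T_norm \<Omega> T fd)\<^sup>2"
    and "\<forall>t\<in>{0..T}. AE x in M. \<phi>d t x = primitive \<Psi> t x"
    and "AE t in N. (AE x in M. \<psi>d t x = \<Psi> t x) \<and> (AE x in M. \<mu>d t x = m t x)
      \<and> (AE x in M. fd t x = F t x) \<and> (AE x in M. \<phi>d t x = primitive \<Psi> t x)"
proof -
  note paths1 = limiting_solution_L2T[OF solution1] and paths2 = limiting_solution_L2T[OF solution2]
  obtain \<Psi> where \<Psi>: "L2_path \<Psi>" "AE z in N \<Otimes>\<^sub>M M. case_prod \<psi>d z = case_prod \<Psi> z"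
    by (rule L2T_ex_path[OF L2T_diff[OF paths1(2) paths2(2)]]) blast
  obtain m where m: "L2_path m" "AE z in N \<Otimes>\<^sub>M M. case_prod \<mu>d z = case_prod m z"
    by (rule L2T_ex_path[OF L2T_diff[OF paths1(3) paths2(3)]]) blast
  obtain F where F: "L2_path F" "AE z in N \<Otimes>\<^sub>M M. case_prod fd z = case_prod F z"
    "(\<integral>t. inner_L2 M (F t) (F t) \<partial>N) = (L2T_norm \<Omega> T fd)\<^sup>2"
    by (rule L2T_ex_path[OF L2T_diff[OF forcing1 forcing2]])
  have primitive: "\<forall>t\<in>{0..T}. AE x in M. \<phi>d t x = primitive \<Psi> t x"
    using difference_primitive[OF \<Psi>(2)] by blast
  have "AE t in N. (AE x in M. \<psi>d t x = \<Psi> t x) \<and> (AE x in M. \<mu>d t x = m t x)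
      \<and> (AE x in M. fd t x = F t x) \<and> (AE x in M. \<phi>d t x = primitive \<Psi> t x)"
    using AE_pair[OF \<Psi>(2)] AE_pair[OF m(2)] AE_pair[OF F(2)] AE_space
    by eventually_elim (simp add: primitive)
  with \<Psi>(1) m(1) F(1,3) primitive show ?thesis
    by (rule that)
qed

theorem stability:
  assumes t: "t \<in> {0..T}"
  shows "nrm \<Omega> (\<phi>d t) \<le> sqrt (exp ((2 * L + 1) / \<tau> * T) / \<tau>) * L2T_norm \<Omega> T fd"
proof -
  obtain \<Psi> m F where paths: "L2_path \<Psi>" "L2_path m" "L2_path F"
    and norm_F: "(\<integral>t. inner_L2 M (F t) (F t) \<partial>N) = (L2T_norm \<Omega> T fd)\<^sup>2"
    and primitive: "\<forall>t\<in>{0..T}. AE x in M. \<phi>d t x = primitive \<Psi> t x"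
    and versions: "AE t in N. (AE x in M. \<psi>d t x = \<Psi> t x) \<and> (AE x in M. \<mu>d t x = m t x)
      \<and> (AE x in M. fd t x = F t x) \<and> (AE x in M. \<phi>d t x = primitive \<Psi> t x)"
    by (rule difference_paths)
  have evolution: "AE t in N. \<forall>j. coeff (\<Psi> t) j + (lam j powr r)\<^sup>2 * coeff (m t) j = 0"
    using difference_evolution versions
  proof eventually_elim
    case (elim t)
    then have "coeff (\<psi>d t) j = coeff (\<Psi> t) j" "coeff (\<mu>d t) j = coeff (m t) j" for j
      by (auto intro: domain.inner_L2_cong_AE)
    with elim(1) show ?case by simp
  qed
  have dissipation: "AE t in N. \<tau> * inner_L2 M (\<Psi> t) (primitive \<Psi> t)
      \<le> inner_L2 M (m t) (primitive \<Psi> t) + inner_L2 M (F t) (primitive \<Psi> t)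
        + L * inner_L2 M (primitive \<Psi> t) (primitive \<Psi> t)"
    using difference_dissipation versions
  proof eventually_elim
    case (elim t)
    then have cong: "inner_L2 M (\<psi>d t) (\<phi>d t) = inner_L2 M (\<Psi> t) (primitive \<Psi> t)"
      "inner_L2 M (\<mu>d t) (\<phi>d t) = inner_L2 M (m t) (primitive \<Psi> t)"
      "inner_L2 M (fd t) (\<phi>d t) = inner_L2 M (F t) (primitive \<Psi> t)"
      "inner_L2 M (\<phi>d t) (\<phi>d t) = inner_L2 M (primitive \<Psi> t) (primitive \<Psi> t)"
      by (auto intro: domain.inner_L2_cong_AE)
    from elim(1) show ?case unfolding cong .
  qed
  have "(nrm \<Omega> (\<phi>d t))\<^sup>2 = inner_L2 M (primitive \<Psi> t) (primitive \<Psi> t)"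
    unfolding nrm_eq_norm_L2 norm_L2_square by (intro domain.inner_L2_cong_AE bspec[OF primitive t])
  also have "\<dots> \<le> exp ((2 * L + 1) / \<tau> * T) / \<tau> * (L2T_norm \<Omega> T fd)\<^sup>2"
    unfolding norm_F[symmetric]
    by (rule energy_estimate[OF paths _ evolution dissipation relaxation_pos Lipschitz_const_nonneg t]) simp
  also have "\<dots> = (sqrt (exp ((2 * L + 1) / \<tau> * T) / \<tau>) * L2T_norm \<Omega> T fd)\<^sup>2"
    using relaxation_pos by (simp add: power_mult_distrib)
  finally show ?thesis
    by (rule power2_le_imp_le) (use relaxation_pos in \<open>simp add: L2T_norm_def case_prod_beta'\<close>)
qed

end

theorem theorem2p10:
  fixes \<tau> T L :: real
  assumes "0 < \<tau>" and "0 < T" and "0 \<le> L"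
  shows "\<exists>C::real. \<forall>\<Omega> lam e lam' e' r \<sigma>0 \<beta> \<pi>h \<pi> \<phi>0 f1 f2 \<phi>1 \<phi>2 \<psi>1 \<psi>2 \<mu>1 \<mu>2.
     setting \<Omega> lam e lam' e' r \<sigma>0 \<tau> \<beta> \<pi>h \<pi> L \<and>
     \<phi>0 \<in> spec_dom \<Omega> lam' e' \<sigma>0 \<and> int_beta \<Omega> \<beta> \<phi>0 < \<infinity> \<and>
     L2T \<Omega> T f1 \<and> L2T \<Omega> T f2 \<and>
     limiting_solution \<Omega> lam e lam' e' r \<tau> T \<beta> \<pi> \<phi>0 f1 \<phi>1 \<psi>1 \<mu>1 \<and>
     limiting_solution \<Omega> lam e lam' e' r \<tau> T \<beta> \<pi> \<phi>0 f2 \<phi>2 \<psi>2 \<mu>2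
     \<longrightarrow> (\<forall>t\<in>{0..T}. nrm \<Omega> (\<lambda>x. \<phi>1 t x - \<phi>2 t x)
                        \<le> C * L2T_norm \<Omega> T (\<lambda>t x. f1 t x - f2 t x))"
proof (rule exI[of _ "sqrt (exp ((2 * L + 1) / \<tau> * T) / \<tau>)"], intro allI impI ballI, elim conjE)
  fix \<Omega> lam e lam' e' r \<sigma>0 \<beta> \<pi>h \<pi> \<phi>0 f1 f2 \<phi>1 \<phi>2 \<psi>1 \<psi>2 \<mu>1 \<mu>2 t
  assume "setting \<Omega> lam e lam' e' r \<sigma>0 \<tau> \<beta> \<pi>h \<pi> L" "L2T \<Omega> T f1" "L2T \<Omega> T f2"
    and "limiting_solution \<Omega> lam e lam' e' r \<tau> T \<beta> \<pi> \<phi>0 f1 \<phi>1 \<psi>1 \<mu>1"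
    and "limiting_solution \<Omega> lam e lam' e' r \<tau> T \<beta> \<pi> \<phi>0 f2 \<phi>2 \<psi>2 \<mu>2"
  then interpret limiting_solution_pair \<Omega> lam e lam' e' r \<sigma>0 \<tau> \<beta> \<pi>h \<pi> L T \<phi>0 f1 f2 \<phi>1 \<phi>2 \<psi>1 \<psi>2 \<mu>1 \<mu>2
    by unfold_locales
  assume "t \<in> {0..T}"
  then show "nrm \<Omega> (\<lambda>x. \<phi>1 t x - \<phi>2 t x)
      \<le> sqrt (exp ((2 * L + 1) / \<tau> * T) / \<tau>) * L2T_norm \<Omega> T (\<lambda>t x. f1 t x - f2 t x)"
    by (rule stability)
qed

end
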